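(* Let $\mu$ be a permuton. If $\mu$ is absolutely continuous with respect to the Lebesgue measure on $[0,1]^2$, then $$\lim_{n\to\infty}\frac{H_n(\mu)}{n\log n}=1.$$ More specifically, for an arbitrary permuton $\mu$ whose absolutely continuous part (in the Lebesgue decomposition with respect to the Lebesgue measure on $[0,1]^2$) is denoted by $\mu_{\mathrm{ac}}$, $$\liminf_{n\to\infty}\frac{H_n(\mu)}{n\log n}\ \geq\ \|\mu_{\mathrm{ac}}\|,$$ where $\|\mu_{\mathrm{ac}}\|$ is the total mass of $\mu_{\mathrm{ac}}$.
   Context: A permuton is a Borel probability measure on $[0,1]^2$ whose two one-dimensional marginals are both uniform on $[0,1]$. For a permuton $\mu$ and $n\ge 1$, draw $n$ i.i.d. points from $\mu$ (almost surely all $x$-coordinates are distinct and all $y$-coordinates are distinct) and read the relative order of their heights from left to right; this gives a random permutation in $\mathrm{Sym}(n)$. Its distribution on $\mathrm{Sym}(n)$ is denoted $\mu^{(n)}$, and $H_n(\mu)=-\sum_{\sigma\in \mathrm{Sym}(n)}\mu^{(n)}(\sigma)\log\mu^{(n)}(\sigma)$ is its Shannon entropy (natural logarithm, $0\log 0=0$). *)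

theory Defs
  imports "HOL-Probability.Probability"
begin

text \<open>Permutons live on the closed unit square itself: the underlying space of a permuton is
  \<open>unit_square\<close>, not the whole plane.\<close>

abbreviation unit_square :: "(real \<times> real) set" where
  "unit_square \<equiv> {0..1} \<times> {0..1}"

abbreviation lebesgue_square :: "(real \<times> real) measure" where
  "lebesgue_square \<equiv> restrict_space lborel unit_square"

definition permuton :: "(real \<times> real) measure \<Rightarrow> bool" where
  "permuton \<mu> \<longleftrightarrow>
     prob_space \<mu> \<and> sets \<mu> = sets (restrict_space borel unit_square) \<and>
     distr \<mu> borel fst = uniform_measure lborel {0..1} \<and>
     distr \<mu> borel snd = uniform_measure lborel {0..1}"


text \<open>Point configurations are functions \<open>z\<close> on \<open>{1..n}\<close>; the rank of \<open>f (z i)\<close> among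
  \<open>f (z 1), \<dots>, f (z n)\<close> counts from \<open>1\<close>.\<close>

definition rank_by :: "('a \<Rightarrow> real) \<Rightarrow> nat \<Rightarrow> (nat \<Rightarrow> 'a) \<Rightarrow> nat \<Rightarrow> nat" where
  "rank_by f n z i = card {j \<in> {1..n}. f (z j) \<le> f (z i)}"

text \<open>\<open>\<sigma>\<close> sends \<open>k\<close> to the height rank of the \<open>k\<close>-th point from the left. Configurations with
  coinciding abscissae or coinciding ordinates have no pattern.\<close>

definition has_pattern :: "nat \<Rightarrow> (nat \<Rightarrow> real \<times> real) \<Rightarrow> (nat \<Rightarrow> nat) \<Rightarrow> bool" where
  "has_pattern n z \<sigma> \<longleftrightarrow>
     inj_on (\<lambda>i. fst (z i)) {1..n} \<and> inj_on (\<lambda>i. snd (z i)) {1..n} \<and>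
     (\<forall>i\<in>{1..n}. \<sigma> (rank_by fst n z i) = rank_by snd n z i)"

text \<open>The mass \<open>\<mu>\<^sup>(\<^sup>n\<^sup>)(\<sigma>)\<close>.\<close>

definition pattern_prob :: "(real \<times> real) measure \<Rightarrow> nat \<Rightarrow> (nat \<Rightarrow> nat) \<Rightarrow> real" where
  "pattern_prob \<mu> n \<sigma> =
     measure (\<Pi>\<^sub>M i\<in>{1..n}. \<mu>) {z \<in> space (\<Pi>\<^sub>M i\<in>{1..n}. \<mu>). has_pattern n z \<sigma>}"

text \<open>The convention \<open>0 log 0 = 0\<close> holds automatically.\<close>

definition perm_entropy :: "(real \<times> real) measure \<Rightarrow> nat \<Rightarrow> real" where
  "perm_entropy \<mu> n =
     - (\<Sum>\<sigma> | \<sigma> permutes {1..n}. pattern_prob \<mu> n \<sigma> * ln (pattern_prob \<mu> n \<sigma>))"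


definition mutually_singular :: "'a measure \<Rightarrow> 'a measure \<Rightarrow> bool" where
  "mutually_singular M N \<longleftrightarrow>
     (\<exists>S \<in> sets M. emeasure M S = 0 \<and> emeasure N (space N - S) = 0)"

text \<open>Decomposition of \<open>N\<close> with respect to the reference measure \<open>M\<close>.\<close>

definition lebesgue_decomposition ::
  "'a measure \<Rightarrow> 'a measure \<Rightarrow> 'a measure \<Rightarrow> 'a measure \<Rightarrow> bool" where
  "lebesgue_decomposition M N N_ac N_s \<longleftrightarrow>
     sets N_ac = sets N \<and> sets N_s = sets N \<and>
     (\<forall>A \<in> sets N. emeasure N A = emeasure N_ac A + emeasure N_s A) \<and>
     absolutely_continuous M N_ac \<and> mutually_singular M N_s"

lemma lebesgue_decomposition_exists:
  assumes sets_eq: "sets N = sets M" and fin: "finite_measure N"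
  obtains N_ac N_s where "lebesgue_decomposition M N N_ac N_s"
proof -
  interpret finite_measure N by fact
  have "null_sets M \<noteq> {}" by auto
  then obtain f where f: "range f \<subseteq> emeasure N ` null_sets M"
    and SUP_f: "(SUP A \<in> null_sets M. emeasure N A) = (SUP i::nat. f i)"
    using ennreal_SUP_countable_SUP[of "null_sets M" "emeasure N"] by auto
  from f have "\<forall>i. \<exists>A. A \<in> null_sets M \<and> f i = emeasure N A" by auto
  then obtain A where A: "\<And>i. A i \<in> null_sets M" "\<And>i. f i = emeasure N (A i)"
    by metis
  define S where "S = (\<Union>i. A i)"
  have S_null: "S \<in> null_sets M" unfolding S_def using A(1) by auto
  then have S [measurable]: "S \<in> sets N" using sets_eq by auto
  have S_max: "emeasure N B \<le> emeasure N S" if "B \<in> null_sets M" for B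
  proof -
    have "emeasure N B \<le> (SUP i. f i)"
      unfolding SUP_f[symmetric] using that by (rule SUP_upper)
    also have "\<dots> \<le> emeasure N S"
      unfolding A(2) by (intro SUP_least emeasure_mono S) (auto simp: S_def)
    finally show ?thesis .
  qed
  have null: "emeasure N (B - S) = 0" if B: "B \<in> null_sets M" for B
  proof -
    have [measurable]: "B \<in> sets N" using B sets_eq by auto
    have "emeasure N S + emeasure N (B - S) = emeasure N (S \<union> (B - S))"
      by (intro plus_emeasure) auto
    also have "S \<union> (B - S) = B \<union> S" by auto
    also have "emeasure N (B \<union> S) \<le> emeasure N S + 0"
      using S_max[of "B \<union> S"] B S_null by auto
    finally show ?thesis by (simp add: ennreal_add_left_cancel_le)
  qed
  define N_ac where "N_ac = density N (indicator (space N - S))"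
  define N_s where "N_s = density N (indicator S)"
  have ac: "emeasure N_ac B = emeasure N (B - S)" if B: "B \<in> sets N" for B
  proof -
    have "B \<inter> (space N - S) = B - S" using sets.sets_into_space[OF B] by auto
    then show ?thesis using B
      by (simp add: N_ac_def emeasure_density Int_commute flip: indicator_inter_arith)
  qed
  have s: "emeasure N_s B = emeasure N (B \<inter> S)" if B: "B \<in> sets N" for B
    using B by (simp add: N_s_def emeasure_density Int_commute flip: indicator_inter_arith)
  have sets: "sets N_ac = sets N" "sets N_s = sets N" by (simp_all add: N_ac_def N_s_def)
  have "emeasure N B = emeasure N_ac B + emeasure N_s B" if "B \<in> sets N" for B
  proof -
    have "emeasure N (B - S) + emeasure N (B \<inter> S) = emeasure N ((B - S) \<union> (B \<inter> S))"
      using that by (intro plus_emeasure) auto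
    also have "(B - S) \<union> (B \<inter> S) = B" by auto
    finally show ?thesis using that by (simp add: ac s)
  qed
  moreover have "absolutely_continuous M N_ac"
    unfolding absolutely_continuous_def
  proof
    fix B assume B: "B \<in> null_sets M"
    then have "B \<in> sets N" using sets_eq by auto
    then show "B \<in> null_sets N_ac"
      using ac null[OF B] sets by (intro null_setsI) simp_all
  qed
  moreover have "mutually_singular M N_s"
    unfolding mutually_singular_def
  proof (intro bexI conjI)
    have "emeasure N_s (space N - S) = emeasure N ((space N - S) \<inter> S)" by (intro s) auto
    also have "(space N - S) \<inter> S = {}" by auto
    finally show "emeasure N_s (space N_s - S) = 0" by (simp add: N_s_def)
  qed (use S_null in auto)
  ultimately have "lebesgue_decomposition M N N_ac N_s"
    using sets by (auto simp: lebesgue_decomposition_def)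
  then show thesis by (rule that)
qed

end

theory Submission
  imports Defs
begin

text \<open>Suppose that \<open>\<mu>\<close> is dominated by \<open>K\<close> times Lebesgue measure on a set \<open>G\<close>. Sampled points
  that fall into \<open>G\<close> are then, up to a factor \<open>K\<close> per point, points with independent uniform
  coordinates, and for such points every order of the heights of \<open>m\<close> points is equally likely and
  has probability at most \<open>1 / m!\<close>. So if \<open>I\<close> is a set of \<open>m\<close> indices, a given pattern occurs with the
  points of \<open>I\<close> in \<open>G\<close> with probability at most \<open>K ^ m / m!\<close>
  (\<open>emeasure_pattern_in_le\<close>), whatever the remaining points do: they and the abscissae can be fixed
  first, and the pattern then prescribes the order of the remaining \<open>m\<close> heights.

  Recording which of the \<open>n\<close> points lie in \<open>G\<close> distinguishes \<open>2 ^ n\<close> cases, which is worth at most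
  \<open>n ln 2\<close> of entropy (\<open>entropy_refinement_le\<close>). A pattern refined in this way carries information
  at least \<open>ln (m!) - m ln K \<ge> m ln n - O(n)\<close>, where \<open>m\<close> is the number of points in \<open>G\<close>, and the
  mean of \<open>m\<close> is \<open>n \<mu>(G)\<close>. Hence the entropy is at least \<open>\<mu>(G) n ln n - O(n)\<close>
  (\<open>perm_entropy_ge\<close>). Sublevel sets of the density of the absolutely continuous part, with the singular support
  removed, serve as \<open>G\<close> and exhaust the mass of that part (\<open>ex_bounded_density_set\<close>), which gives the
  bound on the lower limit.

  In the absolutely continuous case this lower bound is \<open>1\<close>, and it is matched by the trivial upper
  bound \<open>ln (n!) \<le> n ln n\<close> (\<open>perm_entropy_le\<close>).\<close>

section \<open>Entropy of a refinement\<close>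

text \<open>Gibbs' inequality: learning which of the \<open>card C\<close> classes occurred adds at most
  \<open>ln (card C)\<close> to the entropy. Termwise it is \<open>ln x \<le> x - 1\<close> at
  \<open>x = p s / (card C * q s c)\<close>, whose right-hand sides cancel in the sum. With a single \<open>s\<close>
  it becomes the bound of the entropy by the logarithm of the number of outcomes.\<close>

lemma entropy_refinement_le:
  fixes q :: "'a \<Rightarrow> 'b \<Rightarrow> real"
  assumes fin: "finite S" "finite C" and "C \<noteq> {}"
    and nonneg: "\<And>s c. s \<in> S \<Longrightarrow> c \<in> C \<Longrightarrow> 0 \<le> q s c"
  defines "p \<equiv> \<lambda>s. \<Sum>c\<in>C. q s c"
  shows "- (\<Sum>s\<in>S. \<Sum>c\<in>C. q s c * ln (q s c)) \<le>
         - (\<Sum>s\<in>S. p s * ln (p s)) + ln (card C) * (\<Sum>s\<in>S. p s)"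
proof -
  define N where "N = real (card C)"
  have N: "N > 0" using assms by (simp add: N_def card_gt_0_iff)
  have term_le: "q s c * ln (p s) - q s c * ln (q s c) - ln N * q s c \<le> p s / N - q s c"
    if "s \<in> S" "c \<in> C" for s c
  proof (cases "q s c = 0")
    case True
    then show ?thesis using N nonneg that by (simp add: p_def sum_nonneg)
  next
    case False
    then have q: "q s c > 0" using nonneg[OF that] by simp
    have "q s c \<le> p s" unfolding p_def
      using that nonneg fin by (intro member_le_sum) auto
    then have p: "p s > 0" using q by simp
    have "ln (p s / (N * q s c)) \<le> p s / (N * q s c) - 1"
      using p q N by (intro ln_le_minus_one) simp
    then have "q s c * ln (p s / (N * q s c)) \<le> q s c * (p s / (N * q s c) - 1)"
      using q by (simp add: mult_left_mono)
    moreover have "ln (p s / (N * q s c)) = ln (p s) - ln N - ln (q s c)"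
      using p q N by (simp add: ln_div ln_mult)
    ultimately have "q s c * (ln (p s) - ln N - ln (q s c)) \<le> q s c * (p s / (N * q s c) - 1)"
      by simp
    also have "\<dots> = p s / N - q s c" using q N by (simp add: right_diff_distrib)
    finally show ?thesis by (simp add: algebra_simps)
  qed
  have "(\<Sum>s\<in>S. \<Sum>c\<in>C. q s c * ln (p s) - q s c * ln (q s c) - ln N * q s c)
      \<le> (\<Sum>s\<in>S. \<Sum>c\<in>C. p s / N - q s c)"
    by (intro sum_mono term_le)
  also have "\<dots> = 0"
    using N by (simp add: sum_subtractf N_def) (simp add: p_def)
  finally show ?thesis
    by (simp add: sum_subtractf N_def p_def flip: sum_distrib_left sum_distrib_right)
qed

section \<open>Uniformly random orders\<close>

text \<open>A single term of the exponential series. Read as \<open>ln (m!) \<ge> m ln n - n\<close>, it is a form of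
  Stirling's bound whose error is linear in \<open>n\<close> uniformly in \<open>m\<close>.\<close>

lemma power_le_exp_mult_fact: "real n ^ m \<le> exp (real n) * fact m"
proof -
  have "real n ^ m /\<^sub>R fact m = (\<Sum>k\<in>{m}. real n ^ k /\<^sub>R fact k)" by simp
  also have "\<dots> \<le> (\<Sum>k. real n ^ k /\<^sub>R fact k)"
    by (intro sum_le_suminf summable_exp_generic) auto
  finally show ?thesis by (simp add: exp_def field_simps)
qed

text \<open>Vectors whose coordinates are distinct and ordered like the labels \<open>h\<close>. They are taken
  extensional so that the set lies inside the product space over \<open>I\<close>.\<close>

definition order_iso_set :: "'i set \<Rightarrow> ('i \<Rightarrow> nat) \<Rightarrow> ('i \<Rightarrow> real) set" where
  "order_iso_set I h = {v \<in> extensional I. inj_on v I \<and> (\<forall>i\<in>I. \<forall>j\<in>I. v i \<le> v j \<longleftrightarrow> h i \<le> h j)}"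

lemma rank_le_iff:
  fixes v :: "'i \<Rightarrow> real"
  assumes "finite I" "a \<in> I" "b \<in> I"
  shows "card {j\<in>I. v j \<le> v a} \<le> card {j\<in>I. v j \<le> v b} \<longleftrightarrow> v a \<le> v b"
proof
  assume "v a \<le> v b"
  then show "card {j\<in>I. v j \<le> v a} \<le> card {j\<in>I. v j \<le> v b}"
    using assms by (intro card_mono) auto
next
  assume le: "card {j\<in>I. v j \<le> v a} \<le> card {j\<in>I. v j \<le> v b}"
  show "v a \<le> v b"
  proof (rule ccontr)
    assume "\<not> v a \<le> v b"
    then have "{j\<in>I. v j \<le> v b} \<subset> {j\<in>I. v j \<le> v a}" using assms by auto
    then have "card {j\<in>I. v j \<le> v b} < card {j\<in>I. v j \<le> v a}"
      using assms by (intro psubset_card_mono) auto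
    with le show False by simp
  qed
qed

text \<open>A finite set of distinct reals is listed in a prescribed order in only one way: the value at
  position \<open>i\<close> is identified by its rank, and the rank is determined by \<open>h\<close>.\<close>

lemma reindexing_unique:
  fixes v :: "'i \<Rightarrow> real"
  assumes fin: "finite I" and per: "\<pi> permutes I" "\<pi>' permutes I"
    and v: "inj_on v I"
    and iso: "\<And>i j. i \<in> I \<Longrightarrow> j \<in> I \<Longrightarrow> v (\<pi> i) \<le> v (\<pi> j) \<longleftrightarrow> h i \<le> (h j :: nat)"
             "\<And>i j. i \<in> I \<Longrightarrow> j \<in> I \<Longrightarrow> v (\<pi>' i) \<le> v (\<pi>' j) \<longleftrightarrow> h i \<le> h j"
  shows "\<pi> = \<pi>'"
proof
  fix i
  have rank: "card {j\<in>I. v j \<le> v (\<tau> i)} = card {j\<in>I. h j \<le> h i}"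
    if "\<tau> permutes I" "i \<in> I" and "\<And>i j. i \<in> I \<Longrightarrow> j \<in> I \<Longrightarrow> v (\<tau> i) \<le> v (\<tau> j) \<longleftrightarrow> h i \<le> h j"
    for \<tau>
  proof -
    have "{j\<in>I. v j \<le> v (\<tau> i)} = \<tau> ` {j\<in>I. h j \<le> h i}"
      using that permutes_image[OF that(1)] by (auto 0 3 simp: image_iff)
    then show ?thesis
      by (simp add: card_image permutes_inj_on[OF that(1)])
  qed
  show "\<pi> i = \<pi>' i"
  proof (cases "i \<in> I")
    case True
    have "card {j\<in>I. v j \<le> v (\<pi> i)} = card {j\<in>I. v j \<le> v (\<pi>' i)}"
      using rank[OF per(1) True iso(1)] rank[OF per(2) True iso(2)] by simp
    moreover have in_I: "\<pi> i \<in> I" "\<pi>' i \<in> I" using per True by (simp_all add: permutes_in_image)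
    ultimately have "v (\<pi> i) = v (\<pi>' i)"
      using rank_le_iff[OF fin in_I, of v] rank_le_iff[OF fin in_I(2,1), of v] by simp
    then show ?thesis using v in_I by (auto dest: inj_onD)
  qed (use per in \<open>simp add: permutes_def\<close>)
qed

lemma sets_order_iso_set [measurable]:
  assumes "finite I"
  shows "order_iso_set I h \<in> sets (\<Pi>\<^sub>M i\<in>I. (borel :: real measure))"
proof -
  let ?P = "\<Pi>\<^sub>M i\<in>I. (borel :: real measure)"
  have "{v \<in> space ?P. (v i = v j \<longrightarrow> i = j) \<and> (v i \<le> v j \<longleftrightarrow> h i \<le> h j)} \<in> sets ?P"
    if "i \<in> I" "j \<in> I" for i j
  proof -
    have le: "{v \<in> space ?P. v i \<le> v j} \<in> sets ?P" and eq: "{v \<in> space ?P. v i = v j} \<in> sets ?P"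
      using that by (auto intro!: borel_measurable_le borel_measurable_eq measurable_component_singleton)
    show ?thesis
      by (cases "h i \<le> h j"; simp; intro sets.sets_Collect le eq)
  qed
  then have "{v \<in> space ?P. \<forall>i\<in>I. \<forall>j\<in>I. (v i = v j \<longrightarrow> i = j) \<and> (v i \<le> v j \<longleftrightarrow> h i \<le> h j)} \<in> sets ?P"
    using assms by (intro sets.sets_Collect_finite_All) auto
  also have "{v \<in> space ?P. \<forall>i\<in>I. \<forall>j\<in>I. (v i = v j \<longrightarrow> i = j) \<and> (v i \<le> v j \<longleftrightarrow> h i \<le> h j)}
      = order_iso_set I h"
    by (auto simp: order_iso_set_def space_PiM PiE_def inj_on_def)
  finally show ?thesis .
qed

text \<open>The \<open>card I!\<close> rearrangements of an i.i.d. vector have the same law, and by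
  \<open>reindexing_unique\<close> at most one of them is ordered like \<open>h\<close>, so these equally likely
  disjoint events have total probability at most \<open>1\<close>. Vectors with ties
  lie in none of these events, so the total may be smaller than \<open>1\<close>.\<close>

lemma emeasure_order_iso_set_le:
  fixes U :: "real measure"
  assumes U: "prob_space U" "sets U = sets borel" and fin: "finite I"
  shows "emeasure (\<Pi>\<^sub>M i\<in>I. U) (order_iso_set I h) \<le> ennreal (1 / fact (card I))"
proof -
  let ?P = "\<Pi>\<^sub>M i\<in>I. U"
  interpret P: prob_space ?P by (intro prob_space_PiM U)
  have [measurable_cong]: "sets U = sets borel" by fact
  have sets_P: "sets ?P = sets (\<Pi>\<^sub>M i\<in>I. borel)" by (intro sets_PiM_cong refl U)
  have space_P: "space ?P = extensional I"
    using U(2)[THEN sets_eq_imp_space_eq] by (simp add: space_PiM PiE_def)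
  have T[measurable]: "order_iso_set I h \<in> sets ?P"
    using sets_order_iso_set[OF fin] by (simp add: sets_P)
  define R where "R \<pi> v = (\<lambda>i\<in>I. v (\<pi> i))" for \<pi> :: "'a \<Rightarrow> 'a" and v :: "'a \<Rightarrow> real"
  define D where "D \<pi> = R \<pi> -` order_iso_set I h \<inter> space ?P" for \<pi>
  have R_meas: "R \<pi> \<in> measurable ?P ?P" if "\<pi> permutes I" for \<pi>
    unfolding R_def using permutes_in_image[OF that]
    by (intro measurable_restrict measurable_component_singleton) auto
  have distr: "distr ?P ?P (R \<pi>) = ?P" if "\<pi> permutes I" for \<pi>
    unfolding R_def using distr_PiM_reindex[of I "\<lambda>_. U" \<pi> I] that U
    by (auto simp: permutes_inj_on permutes_in_image)
  have D: "D \<pi> \<in> sets ?P" "P.prob (D \<pi>) = P.prob (order_iso_set I h)" if "\<pi> permutes I" for \<pi>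
  proof -
    show "D \<pi> \<in> sets ?P" unfolding D_def using R_meas[OF that] T by (rule measurable_sets)
    have "P.prob (D \<pi>) = measure (distr ?P ?P (R \<pi>)) (order_iso_set I h)"
      unfolding D_def using R_meas[OF that] T by (rule measure_distr[symmetric])
    then show "P.prob (D \<pi>) = P.prob (order_iso_set I h)" by (simp add: distr[OF that])
  qed
  have disj: "disjoint_family_on D {\<pi>. \<pi> permutes I}"
  unfolding disjoint_family_on_def
  proof (intro ballI impI, rule ccontr)
    fix \<pi> \<pi>' assume *: "\<pi> \<in> {\<pi>. \<pi> permutes I}" "\<pi>' \<in> {\<pi>. \<pi> permutes I}" "\<pi> \<noteq> \<pi>'" "D \<pi> \<inter> D \<pi>' \<noteq> {}"
    then obtain v where v: "R \<pi> v \<in> order_iso_set I h" "R \<pi>' v \<in> order_iso_set I h"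
      by (auto simp: D_def)
    have "inj_on (v \<circ> \<pi>) I"
      using v(1) by (auto simp: order_iso_set_def R_def inj_on_def)
    then have "inj_on v I"
      using inj_on_imageI[of v \<pi> I] permutes_image[of \<pi> I] * by simp
    then have "\<pi> = \<pi>'"
      using * v by (intro reindexing_unique[OF fin, of _ _ v h]) (auto simp: order_iso_set_def R_def)
    with * show False by simp
  qed
  have "fact (card I) * P.prob (order_iso_set I h) = (\<Sum>\<pi> | \<pi> permutes I. P.prob (D \<pi>))"
    using fin by (simp add: D card_permutations)
  also have "\<dots> = P.prob (\<Union>\<pi>\<in>{\<pi>. \<pi> permutes I}. D \<pi>)"
    using fin disj D by (intro P.finite_measure_finite_Union[symmetric]) (auto simp: finite_permutations)
  also have "\<dots> \<le> 1" by simp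
  finally have "P.prob (order_iso_set I h) \<le> 1 / fact (card I)"
    by (simp add: field_simps)
  then show ?thesis by (simp add: P.emeasure_eq_measure)
qed

section \<open>Domination by a product law\<close>

lemma nn_integral_le_of_dominated:
  fixes \<mu> :: "(real \<times> real) measure" and U :: "real measure"
  assumes U: "prob_space U" "sets U = sets borel"
    and id_meas: "(\<lambda>x. x) \<in> measurable \<mu> borel"
    and G[measurable]: "G \<in> sets \<mu>"
    and dom: "\<And>B. B \<in> sets borel \<Longrightarrow> emeasure \<mu> (B \<inter> G) \<le> K * emeasure (U \<Otimes>\<^sub>M U) B"
    and f[measurable]: "f \<in> borel_measurable borel"
  shows "(\<integral>\<^sup>+x. indicator G x * f x \<partial>\<mu>) \<le> K * (\<integral>\<^sup>+a. \<integral>\<^sup>+b. f (a, b) \<partial>U \<partial>U)"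
proof -
  interpret U: prob_space U by fact
  note [measurable_cong] = U(2)
  note [measurable] = id_meas
  have sets_UU: "sets (U \<Otimes>\<^sub>M U) = sets borel"
    using sets_pair_measure_cong[OF U(2) U(2)] by (simp add: borel_prod[symmetric])
  have f': "f \<in> borel_measurable (U \<Otimes>\<^sub>M U)"
    using f measurable_cong_sets[OF sets_UU refl] by blast
  define \<nu> where "\<nu> = distr (density \<mu> (indicator G)) (U \<Otimes>\<^sub>M U) (\<lambda>x. x)"
  have m: "(\<lambda>x. x) \<in> measurable (density \<mu> (indicator G)) (U \<Otimes>\<^sub>M U)"
    using id_meas by (simp add: measurable_cong_sets[OF refl sets_UU])
  have "\<nu> \<le> scale_measure K (U \<Otimes>\<^sub>M U)"
  proof (subst le_measure, simp add: \<nu>_def, intro ballI)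
    fix B assume "B \<in> sets \<nu>"
    then have B: "B \<in> sets borel" by (simp add: \<nu>_def sets_UU)
    have B': "B \<inter> space \<mu> \<in> sets \<mu>" using measurable_sets[OF id_meas B] by simp
    have "emeasure \<nu> B = emeasure (density \<mu> (indicator G)) (B \<inter> space \<mu>)"
      unfolding \<nu>_def using B by (subst emeasure_distr[OF m]) (auto simp: sets_UU)
    also have "\<dots> = emeasure \<mu> (G \<inter> (B \<inter> space \<mu>))"
      using B' by (subst emeasure_density) (auto simp flip: indicator_inter_arith)
    also have "G \<inter> (B \<inter> space \<mu>) = B \<inter> G" using sets.sets_into_space[OF G] by auto
    finally show "emeasure \<nu> B \<le> emeasure (scale_measure K (U \<Otimes>\<^sub>M U)) B"
      using dom[OF B] by simp
  qed
  then have "(\<integral>\<^sup>+x. f x \<partial>\<nu>) \<le> (\<integral>\<^sup>+x. f x \<partial>scale_measure K (U \<Otimes>\<^sub>M U))"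
    by (intro nn_integral_mono_measure) (auto simp: \<nu>_def)
  also have "\<dots> = K * (\<integral>\<^sup>+x. f x \<partial>(U \<Otimes>\<^sub>M U))"
    using f' by (rule nn_integral_scale_measure)
  also have "(\<integral>\<^sup>+x. f x \<partial>(U \<Otimes>\<^sub>M U)) = (\<integral>\<^sup>+a. \<integral>\<^sup>+b. f (a, b) \<partial>U \<partial>U)"
    using f' by (rule U.nn_integral_fst[symmetric])
  also have "(\<integral>\<^sup>+x. f x \<partial>\<nu>) = (\<integral>\<^sup>+x. indicator G x * f x \<partial>\<mu>)"
    unfolding \<nu>_def using f' by (subst nn_integral_distr[OF m]) (simp_all add: nn_integral_density)
  finally show ?thesis .
qed

lemma measurable_id_PiM:
  assumes "(\<lambda>x. x) \<in> measurable M N"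
  shows "(\<lambda>x. x) \<in> measurable (\<Pi>\<^sub>M i\<in>J. M) (\<Pi>\<^sub>M i\<in>J. N)"
proof -
  have "(\<lambda>x. x j) \<in> measurable (\<Pi>\<^sub>M i\<in>J. M) N" if "j \<in> J" for j
    using measurable_compose[OF measurable_component_singleton[OF that, of "\<lambda>_. M"] assms] by simp
  then have "(\<lambda>x. \<lambda>j\<in>J. x j) \<in> measurable (\<Pi>\<^sub>M i\<in>J. M) (\<Pi>\<^sub>M i\<in>J. N)"
    by (intro measurable_restrict)
  then show ?thesis
    by (subst measurable_cong[where g="\<lambda>x. \<lambda>j\<in>J. x j"]) (auto simp: space_PiM)
qed

text \<open>Points of \<open>G\<close> drawn from \<open>\<mu>\<close> may be replaced, at the price of a factor \<open>K\<close> each, by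
  points with independent coordinates of law \<open>U\<close>. In addition the right-hand side draws all
  abscissae before all ordinates, so that the abscissae can later be held fixed while the ordinates
  vary; in the induction this is one exchange of integrals per point.\<close>

lemma nn_integral_PiM_le_of_dominated:
  fixes \<mu> :: "(real \<times> real) measure" and U :: "real measure"
  assumes U: "prob_space U" "sets U = sets borel" and \<mu>: "prob_space \<mu>"
    and id_meas: "(\<lambda>x. x) \<in> measurable \<mu> borel"
    and G[measurable]: "G \<in> sets \<mu>"
    and dom: "\<And>B. B \<in> sets borel \<Longrightarrow> emeasure \<mu> (B \<inter> G) \<le> K * emeasure (U \<Otimes>\<^sub>M U) B"
    and fin: "finite I"
    and f: "f \<in> borel_measurable (\<Pi>\<^sub>M i\<in>I. (borel :: (real \<times> real) measure))"
  shows "(\<integral>\<^sup>+x. (\<Prod>i\<in>I. indicator G (x i)) * f x \<partial>(\<Pi>\<^sub>M i\<in>I. \<mu>)) \<le>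
         K ^ card I * (\<integral>\<^sup>+u. \<integral>\<^sup>+v. f (\<lambda>i\<in>I. (u i, v i)) \<partial>(\<Pi>\<^sub>M i\<in>I. U) \<partial>(\<Pi>\<^sub>M i\<in>I. U))"
  using fin f
proof (induction I arbitrary: f rule: finite_induct)
  case empty
  show ?case by (simp add: PiM_empty nn_integral_count_space_finite)
next
  case (insert i I)
  interpret U: prob_space U by fact
  interpret M: product_sigma_finite "\<lambda>_. \<mu>"
    by (intro product_sigma_finite.intro prob_space_imp_sigma_finite \<mu>)
  interpret P: product_sigma_finite "\<lambda>_. U"
    by (intro product_sigma_finite.intro prob_space_imp_sigma_finite U)
  interpret PI: prob_space "\<Pi>\<^sub>M i\<in>I. U" by (intro prob_space_PiM U)
  interpret PI': prob_space "\<Pi>\<^sub>M j\<in>insert i I. U" by (intro prob_space_PiM U)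
  interpret UP: pair_sigma_finite U "\<Pi>\<^sub>M i\<in>I. U" by standard
  let ?B = "\<lambda>I. \<Pi>\<^sub>M i\<in>I. (borel :: (real \<times> real) measure)"
  note [measurable_cong] = U(2)
  note [measurable] = id_meas
  have f[measurable]: "f \<in> borel_measurable (?B (insert i I))" by fact
  note restr_meas = measurable_id_PiM[OF id_meas]
  have upd: "(\<lambda>y. f (x(i := y))) \<in> borel_measurable borel" if "x \<in> extensional I" for x
    using measurable_compose[OF measurable_component_update f, of x] that \<open>i \<notin> I\<close>
    by (simp add: space_PiM PiE_def)
  have upd_pair: "(\<lambda>(x, a, b). f (x(i := (a, b)))) \<in> borel_measurable (?B I \<Otimes>\<^sub>M U \<Otimes>\<^sub>M U)"
  proof -
    have "(\<lambda>w. (fst w)(i := (fst (snd w), snd (snd w)))) \<in> measurable (?B I \<Otimes>\<^sub>M U \<Otimes>\<^sub>M U) (?B (insert i I))"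
      by (rule measurable_fun_upd[where J=I]) (auto simp: borel_prod[symmetric])
    from measurable_compose[OF this f] show ?thesis by (simp add: split_beta)
  qed
  define g where "g x = (\<integral>\<^sup>+a. \<integral>\<^sup>+b. f (x(i := (a, b))) \<partial>U \<partial>U)" for x
  have g[measurable]: "g \<in> borel_measurable (?B I)"
    unfolding g_def using upd_pair by measurable
  have fm: "(\<lambda>x. (\<Prod>j\<in>insert i I. indicator G (x j)) * f x) \<in> borel_measurable (\<Pi>\<^sub>M j\<in>insert i I. \<mu>)"
    using measurable_compose[OF restr_meas f] by measurable
  have "(\<integral>\<^sup>+x. (\<Prod>j\<in>insert i I. indicator G (x j)) * f x \<partial>(\<Pi>\<^sub>M j\<in>insert i I. \<mu>))
      = (\<integral>\<^sup>+x. \<integral>\<^sup>+y. (\<Prod>j\<in>insert i I. indicator G ((x(i := y)) j)) * f (x(i := y)) \<partial>\<mu> \<partial>(\<Pi>\<^sub>M j\<in>I. \<mu>))"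
    by (rule M.product_nn_integral_insert[OF insert(1,2) fm])
  also have "\<dots> \<le> (\<integral>\<^sup>+x. (\<Prod>j\<in>I. indicator G (x j)) * (K * g x) \<partial>(\<Pi>\<^sub>M j\<in>I. \<mu>))"
  proof (rule nn_integral_mono)
    fix x assume "x \<in> space (\<Pi>\<^sub>M j\<in>I. \<mu>)"
    then have x: "x \<in> extensional I" by (simp add: space_PiM PiE_def)
    note [measurable] = upd[OF x]
    have prod: "(\<Prod>j\<in>insert i I. indicator G ((x(i := y)) j)) = indicator G y * (\<Prod>j\<in>I. indicator G (x j) :: ennreal)" for y
      using insert(1,2) by (auto intro!: arg_cong2[where f="(*)"] prod.cong)
    have "(\<integral>\<^sup>+y. (\<Prod>j\<in>insert i I. indicator G ((x(i := y)) j)) * f (x(i := y)) \<partial>\<mu>)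
        = (\<integral>\<^sup>+y. (\<Prod>j\<in>I. indicator G (x j)) * (indicator G y * f (x(i := y))) \<partial>\<mu>)"
      unfolding prod by (intro nn_integral_cong) (simp add: ac_simps)
    also have "\<dots> = (\<Prod>j\<in>I. indicator G (x j)) * (\<integral>\<^sup>+y. indicator G y * f (x(i := y)) \<partial>\<mu>)"
      using measurable_compose[OF id_meas upd[OF x]] by (intro nn_integral_cmult) measurable
    also have "\<dots> \<le> (\<Prod>j\<in>I. indicator G (x j)) * (K * g x)"
      unfolding g_def by (intro mult_left_mono nn_integral_le_of_dominated[OF U id_meas G dom upd[OF x]]) auto
    finally show "(\<integral>\<^sup>+y. (\<Prod>j\<in>insert i I. indicator G ((x(i := y)) j)) * f (x(i := y)) \<partial>\<mu>)
      \<le> (\<Prod>j\<in>I. indicator G (x j)) * (K * g x)" .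
  qed
  also have "\<dots> \<le> K ^ card I * (\<integral>\<^sup>+u. \<integral>\<^sup>+v. K * g (\<lambda>j\<in>I. (u j, v j)) \<partial>(\<Pi>\<^sub>M j\<in>I. U) \<partial>(\<Pi>\<^sub>M j\<in>I. U))"
    by (rule insert.IH) simp
  also have "\<dots> = K ^ card (insert i I) *
      (\<integral>\<^sup>+u. \<integral>\<^sup>+v. g (\<lambda>j\<in>I. (u j, v j)) \<partial>(\<Pi>\<^sub>M j\<in>I. U) \<partial>(\<Pi>\<^sub>M j\<in>I. U))"
  proof -
    have "(\<lambda>w. \<lambda>j\<in>I. (fst w j, snd w j)) \<in> measurable ((\<Pi>\<^sub>M j\<in>I. U) \<Otimes>\<^sub>M (\<Pi>\<^sub>M j\<in>I. U)) (?B I)"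
      by (intro measurable_restrict) (simp add: borel_prod[symmetric])
    from measurable_compose[OF this g]
    have [measurable]: "(\<lambda>(u, v). g (\<lambda>j\<in>I. (u j, v j))) \<in> borel_measurable ((\<Pi>\<^sub>M j\<in>I. U) \<Otimes>\<^sub>M (\<Pi>\<^sub>M j\<in>I. U))"
      by (simp add: split_beta)
    show ?thesis
      using insert(1,2) by (simp add: nn_integral_cmult ac_simps)
  qed
  also have "(\<integral>\<^sup>+u. \<integral>\<^sup>+v. g (\<lambda>j\<in>I. (u j, v j)) \<partial>(\<Pi>\<^sub>M j\<in>I. U) \<partial>(\<Pi>\<^sub>M j\<in>I. U))
     = (\<integral>\<^sup>+u. \<integral>\<^sup>+v. f (\<lambda>j\<in>insert i I. (u j, v j)) \<partial>(\<Pi>\<^sub>M j\<in>insert i I. U) \<partial>(\<Pi>\<^sub>M j\<in>insert i I. U))"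
  proof -
    have "(\<lambda>w. \<lambda>j\<in>insert i I. (fst w j, snd w j))
        \<in> measurable ((\<Pi>\<^sub>M j\<in>insert i I. U) \<Otimes>\<^sub>M (\<Pi>\<^sub>M j\<in>insert i I. U)) (?B (insert i I))"
      by (intro measurable_restrict) (simp add: borel_prod[symmetric])
    from measurable_compose[OF this f]
    have F: "(\<lambda>(u, v). f (\<lambda>j\<in>insert i I. (u j, v j)))
        \<in> borel_measurable ((\<Pi>\<^sub>M j\<in>insert i I. U) \<Otimes>\<^sub>M (\<Pi>\<^sub>M j\<in>insert i I. U))"
      by (simp add: split_beta)
    have "(\<integral>\<^sup>+u. \<integral>\<^sup>+v. f (\<lambda>j\<in>insert i I. (u j, v j)) \<partial>(\<Pi>\<^sub>M j\<in>insert i I. U) \<partial>(\<Pi>\<^sub>M j\<in>insert i I. U))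
        = (\<integral>\<^sup>+u. \<integral>\<^sup>+a. \<integral>\<^sup>+v. f (\<lambda>j\<in>insert i I. ((u(i := a)) j, v j)) \<partial>(\<Pi>\<^sub>M j\<in>insert i I. U) \<partial>U \<partial>(\<Pi>\<^sub>M j\<in>I. U))"
      by (rule P.product_nn_integral_insert[OF insert(1,2) PI'.borel_measurable_nn_integral[OF F]])
    also have "\<dots> = (\<integral>\<^sup>+u. \<integral>\<^sup>+v. g (\<lambda>j\<in>I. (u j, v j)) \<partial>(\<Pi>\<^sub>M j\<in>I. U) \<partial>(\<Pi>\<^sub>M j\<in>I. U))"
    proof (rule nn_integral_cong)
      fix u assume u: "u \<in> space (\<Pi>\<^sub>M j\<in>I. U)"
      let ?h = "\<lambda>v a b. f ((\<lambda>j\<in>I. (u j, v j))(i := (a, b)))"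
      have eq: "(\<lambda>j\<in>insert i I. ((u(i := a)) j, (v(i := b)) j)) = (\<lambda>j\<in>I. (u j, v j))(i := (a, b))" for v a b
        using \<open>i \<notin> I\<close> by (auto simp: restrict_def fun_eq_iff)
      have "(\<integral>\<^sup>+a. \<integral>\<^sup>+v. f (\<lambda>j\<in>insert i I. ((u(i := a)) j, v j)) \<partial>(\<Pi>\<^sub>M j\<in>insert i I. U) \<partial>U)
          = (\<integral>\<^sup>+a. \<integral>\<^sup>+v. \<integral>\<^sup>+b. ?h v a b \<partial>U \<partial>(\<Pi>\<^sub>M j\<in>I. U) \<partial>U)"
      proof (rule nn_integral_cong)
        fix a assume "a \<in> space U"
        then have "u(i := a) \<in> space (\<Pi>\<^sub>M j\<in>insert i I. U)"
          using u by (auto simp: space_PiM PiE_def extensional_def)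
        then have "(\<lambda>v. f (\<lambda>j\<in>insert i I. ((u(i := a)) j, v j))) \<in> borel_measurable (\<Pi>\<^sub>M j\<in>insert i I. U)"
          using measurable_Pair2[OF F] by simp
        from P.product_nn_integral_insert[OF insert(1,2) this]
        show "(\<integral>\<^sup>+v. f (\<lambda>j\<in>insert i I. ((u(i := a)) j, v j)) \<partial>(\<Pi>\<^sub>M j\<in>insert i I. U))
           = (\<integral>\<^sup>+v. \<integral>\<^sup>+b. ?h v a b \<partial>U \<partial>(\<Pi>\<^sub>M j\<in>I. U))"
          by (simp only: eq)
      qed
      \<comment> \<open>The new abscissa \<open>a\<close> has to be drawn before the old ordinates \<open>v\<close>.\<close>
      also have "\<dots> = (\<integral>\<^sup>+v. \<integral>\<^sup>+a. \<integral>\<^sup>+b. ?h v a b \<partial>U \<partial>U \<partial>(\<Pi>\<^sub>M j\<in>I. U))"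
      proof (rule UP.Fubini'[symmetric])
        have "(\<lambda>w. (\<lambda>j\<in>I. (u j, snd (fst w) j), fst (fst w), snd w))
          \<in> measurable ((U \<Otimes>\<^sub>M (\<Pi>\<^sub>M j\<in>I. U)) \<Otimes>\<^sub>M U) (?B I \<Otimes>\<^sub>M U \<Otimes>\<^sub>M U)"
          by (intro measurable_Pair measurable_restrict) (auto simp: borel_prod[symmetric])
        from measurable_compose[OF this upd_pair]
        have [measurable]: "(\<lambda>w. ?h (snd (fst w)) (fst (fst w)) (snd w)) \<in> borel_measurable ((U \<Otimes>\<^sub>M (\<Pi>\<^sub>M j\<in>I. U)) \<Otimes>\<^sub>M U)"
          by simp
        show "(\<lambda>(a, v). \<integral>\<^sup>+b. ?h v a b \<partial>U) \<in> borel_measurable (U \<Otimes>\<^sub>M (\<Pi>\<^sub>M j\<in>I. U))"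
          using U.borel_measurable_nn_integral[of "\<lambda>w b. ?h (snd w) (fst w) b" "U \<Otimes>\<^sub>M (\<Pi>\<^sub>M j\<in>I. U)"]
          by (simp add: split_beta')
      qed
      also have "\<dots> = (\<integral>\<^sup>+v. g (\<lambda>j\<in>I. (u j, v j)) \<partial>(\<Pi>\<^sub>M j\<in>I. U))" by (simp add: g_def)
      finally show "(\<integral>\<^sup>+a. \<integral>\<^sup>+v. f (\<lambda>j\<in>insert i I. ((u(i := a)) j, v j)) \<partial>(\<Pi>\<^sub>M j\<in>insert i I. U) \<partial>U)
        = (\<integral>\<^sup>+v. g (\<lambda>j\<in>I. (u j, v j)) \<partial>(\<Pi>\<^sub>M j\<in>I. U))" .
    qed
    finally show ?thesis by simp
  qed
  finally show ?case .
qed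

section \<open>Ranks and patterns\<close>

lemma rank_by_le_iff:
  assumes "i \<in> {1..n}" "j \<in> {1..n}"
  shows "rank_by f n z i \<le> rank_by f n z j \<longleftrightarrow> f (z i) \<le> f (z j)"
  unfolding rank_by_def using rank_le_iff[OF _ assms, of "\<lambda>i. f (z i)"] by simp

lemma bij_betw_rank_by:
  assumes "inj_on (\<lambda>i. f (z i)) {1..n}"
  shows "bij_betw (rank_by f n z) {1..n} {1..n}"
proof -
  have inj: "inj_on (rank_by f n z) {1..n}"
  proof (rule inj_onI)
    fix i j assume *: "i \<in> {1..n}" "j \<in> {1..n}" "rank_by f n z i = rank_by f n z j"
    then have "f (z i) = f (z j)"
      using rank_by_le_iff[of i n j f z] rank_by_le_iff[of j n i f z] by simp
    then show "i = j" using assms * by (auto dest: inj_onD)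
  qed
  have "rank_by f n z i \<in> {1..n}" if "i \<in> {1..n}" for i
  proof -
    have "card {i} \<le> rank_by f n z i"
      unfolding rank_by_def using that by (intro card_mono) auto
    moreover have "rank_by f n z i \<le> card {1..n}"
      unfolding rank_by_def by (intro card_mono) auto
    ultimately show ?thesis by simp
  qed
  then have "rank_by f n z ` {1..n} \<subseteq> {1..n}" by auto
  with inj have "rank_by f n z ` {1..n} = {1..n}" by (intro endo_inj_surj) auto
  with inj show ?thesis by (simp add: bij_betw_def)
qed

text \<open>The pattern is forced to be the height ranks composed with the inverse of the horizontal ranks.\<close>

lemma ex1_pattern:
  assumes "inj_on (\<lambda>i. fst (z i)) {1..n}" "inj_on (\<lambda>i. snd (z i)) {1..n}"
  shows "\<exists>!\<sigma>. \<sigma> \<in> {\<sigma>. \<sigma> permutes {1..n}} \<and> has_pattern n z \<sigma>"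
proof -
  define r where "r = rank_by fst n z"
  define s where "s = rank_by snd n z"
  have r: "bij_betw r {1..n} {1..n}" and s: "bij_betw s {1..n} {1..n}"
    unfolding r_def s_def
    by (rule bij_betw_rank_by[of fst, OF assms(1)], rule bij_betw_rank_by[of snd, OF assms(2)])
  have pat: "has_pattern n z \<sigma> \<longleftrightarrow> (\<forall>i\<in>{1..n}. \<sigma> (r i) = s i)" for \<sigma>
    using assms by (simp add: has_pattern_def r_def s_def)
  define \<sigma> where "\<sigma> k = (if k \<in> {1..n} then s (inv_into {1..n} r k) else k)" for k
  have "bij_betw (s \<circ> inv_into {1..n} r) {1..n} {1..n}"
    using bij_betw_inv_into[OF r] s by (rule bij_betw_trans)
  then have "bij_betw \<sigma> {1..n} {1..n}"
    by (subst bij_betw_cong[of _ _ "s \<circ> inv_into {1..n} r"]) (auto simp: \<sigma>_def)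
  then have "\<sigma> permutes {1..n}" by (rule bij_imp_permutes) (auto simp: \<sigma>_def)
  moreover have "has_pattern n z \<sigma>"
    unfolding pat using r by (auto simp: \<sigma>_def bij_betw_def inv_into_f_f)
  moreover have "\<tau> = \<tau>'" if "\<tau> permutes {1..n}" "has_pattern n z \<tau>" "\<tau>' permutes {1..n}" "has_pattern n z \<tau>'" for \<tau> \<tau>'
  proof
    fix k
    show "\<tau> k = \<tau>' k"
    proof (cases "k \<in> {1..n}")
      case True
      then obtain i where "i \<in> {1..n}" "k = r i" using r unfolding bij_betw_def by blast
      then show ?thesis using that by (simp add: pat)
    qed (use that in \<open>simp add: permutes_def\<close>)
  qed
  ultimately show ?thesis by blast
qed

text \<open>Once the abscissae are known, the pattern dictates the order of the ordinates: this is how a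
  pattern becomes an instance of \<open>order_iso_set\<close>.\<close>

lemma has_pattern_snd_le_iff:
  assumes "has_pattern n z \<sigma>" "i \<in> {1..n}" "j \<in> {1..n}"
  shows "snd (z i) \<le> snd (z j) \<longleftrightarrow> \<sigma> (rank_by fst n z i) \<le> \<sigma> (rank_by fst n z j)"
  using assms rank_by_le_iff[OF assms(2,3), of snd z] by (simp add: has_pattern_def)

text \<open>Stated for the Borel plane, where coordinate projections are measurable; it is transported to the
  sigma-algebra of a permuton by the inclusion map.\<close>

lemma sets_has_pattern:
  "{z \<in> space (\<Pi>\<^sub>M i\<in>{1..n}. (borel :: (real \<times> real) measure)). has_pattern n z \<sigma>}
     \<in> sets (\<Pi>\<^sub>M i\<in>{1..n}. (borel :: (real \<times> real) measure))"
proof -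
  let ?B = "\<Pi>\<^sub>M i\<in>{1..n}. (borel :: (real \<times> real) measure)"
  have comp: "(\<lambda>z. fst (z i)) \<in> borel_measurable ?B" "(\<lambda>z. snd (z i)) \<in> borel_measurable ?B"
    if "i \<in> {1..n}" for i
    using measurable_component_singleton[OF that, of "\<lambda>_. borel :: (real \<times> real) measure"]
    by (simp_all add: borel_prod[symmetric])
  have rank: "{z \<in> space ?B. rank_by f n z i = k} \<in> sets ?B"
    if i: "i \<in> {1..n}" and f: "\<And>i. i \<in> {1..n} \<Longrightarrow> (\<lambda>z. f (z i)) \<in> borel_measurable ?B"
    for f :: "real \<times> real \<Rightarrow> real" and i k
  proof -
    have "{z \<in> space ?B. j \<in> {j\<in>{1..n}. f (z j) \<le> f (z i)}} \<in> sets ?B" for j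
    proof (cases "j \<in> {1..n}")
      case True
      then show ?thesis using borel_measurable_le[OF f[OF True] f[OF i]] by simp
    next
      case False
      then have "{z \<in> space ?B. j \<in> {j\<in>{1..n}. f (z j) \<le> f (z i)}} = {}" by auto
      then show ?thesis by (simp only: sets.empty_sets)
    qed
    then have "(\<lambda>z. rank_by f n z i) \<in> measurable ?B (count_space UNIV)"
      unfolding rank_by_def by (rule measurable_card)
    then show ?thesis by measurable
  qed
  have rank': "{z \<in> space ?B. k = rank_by f n z i} \<in> sets ?B"
    if i: "i \<in> {1..n}" and f: "\<And>i. i \<in> {1..n} \<Longrightarrow> (\<lambda>z. f (z i)) \<in> borel_measurable ?B"
    for f :: "real \<times> real \<Rightarrow> real" and i k
    using rank[OF that] by (simp only: eq_commute[of k])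
  have rng: "rank_by f n z i \<le> n" for f :: "real \<times> real \<Rightarrow> real" and z i
  proof -
    have "rank_by f n z i \<le> card {1..n}" unfolding rank_by_def by (intro card_mono) auto
    then show ?thesis by simp
  qed
  \<comment> \<open>The argument of \<open>\<sigma>\<close> is made constant, so that each condition concerns a single rank.\<close>
  have "{z \<in> space ?B. has_pattern n z \<sigma>} = {z \<in> space ?B.
      (\<forall>i\<in>{1..n}. \<forall>j\<in>{1..n}. fst (z i) = fst (z j) \<longrightarrow> i = j) \<and>
      (\<forall>i\<in>{1..n}. \<forall>j\<in>{1..n}. snd (z i) = snd (z j) \<longrightarrow> i = j) \<and>
      (\<forall>i\<in>{1..n}. \<exists>k\<in>{..n}. rank_by fst n z i = k \<and> \<sigma> k = rank_by snd n z i)}"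
    by (intro Collect_cong conj_cong refl) (simp only: has_pattern_def inj_on_def, simp add: rng)
  also have "\<dots> \<in> sets ?B"
    by (intro sets.sets_Collect_conj sets.sets_Collect_finite_All sets.sets_Collect_finite_Ex
        sets.sets_Collect_imp sets.sets_Collect_const borel_measurable_eq[OF comp(1) comp(1)]
        borel_measurable_eq[OF comp(2) comp(2)] rank[OF _ comp(1)] rank'[OF _ comp(2)]
        finite_atLeastAtMost finite_atMost; assumption)
  finally show ?thesis .
qed

section \<open>The probability of a pattern with many points in a dominated set\<close>

text \<open>The decisive estimate. All points outside \<open>I\<close> and the abscissae of the points in \<open>I\<close> are
  held fixed. This fixes all horizontal ranks, hence also the order that \<open>\<sigma>\<close> requires of the
  ordinates indexed by \<open>I\<close>; under the dominating law a prescribed order has probability at most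
  \<open>1 / card I!\<close>. Passing to the dominating law costs \<open>K ^ card I\<close>.\<close>

lemma emeasure_pattern_in_le:
  fixes \<mu> :: "(real \<times> real) measure" and U :: "real measure"
  assumes U: "prob_space U" "sets U = sets borel" and \<mu>: "prob_space \<mu>"
    and id_meas: "(\<lambda>x. x) \<in> measurable \<mu> borel"
    and G[measurable]: "G \<in> sets \<mu>"
    and dom: "\<And>B. B \<in> sets borel \<Longrightarrow> emeasure \<mu> (B \<inter> G) \<le> K * emeasure (U \<Otimes>\<^sub>M U) B"
    and I: "I \<subseteq> {1..n}"
  shows "emeasure (\<Pi>\<^sub>M i\<in>{1..n}. \<mu>)
           {z \<in> space (\<Pi>\<^sub>M i\<in>{1..n}. \<mu>). has_pattern n z \<sigma> \<and> (\<forall>i\<in>I. z i \<in> G)}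
         \<le> K ^ card I * ennreal (1 / fact (card I))"
proof -
  let ?M = "\<lambda>I. \<Pi>\<^sub>M i\<in>I. \<mu>" and ?B = "\<lambda>I. \<Pi>\<^sub>M i\<in>I. (borel :: (real \<times> real) measure)"
  let ?U = "\<Pi>\<^sub>M i\<in>I. U"
  define J where "J = {1..n} - I"
  have JI: "J \<union> I = {1..n}" "J \<inter> I = {}" "finite J" "finite I"
    using I finite_subset[OF I] by (auto simp: J_def)
  interpret M: product_sigma_finite "\<lambda>_. \<mu>"
    by (intro product_sigma_finite.intro prob_space_imp_sigma_finite \<mu>)
  interpret MJ: prob_space "?M J" by (intro prob_space_PiM \<mu>)
  interpret PU: prob_space ?U by (intro prob_space_PiM U)
  define S where "S = {z \<in> space (?B {1..n}). has_pattern n z \<sigma>}"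
  define F :: "(nat \<Rightarrow> real \<times> real) \<Rightarrow> ennreal" where "F = indicator S"
  have F: "F \<in> borel_measurable (?B {1..n})"
    unfolding F_def S_def by (intro borel_measurable_indicator sets_has_pattern)
  have F_M: "F \<in> borel_measurable (?M {1..n})"
    using measurable_compose[OF measurable_id_PiM[OF id_meas] F] .
  have prod_meas: "(\<lambda>z. \<Prod>i\<in>I. indicator G (z i) :: ennreal) \<in> borel_measurable (?M {1..n})"
  proof (rule borel_measurable_prod_ennreal)
    fix i assume "i \<in> I"
    then have [measurable]: "(\<lambda>z. z i) \<in> measurable (?M {1..n}) \<mu>"
      using I by (intro measurable_component_singleton) auto
    show "(\<lambda>z. indicator G (z i) :: ennreal) \<in> borel_measurable (?M {1..n})" by measurable
  qed
  have space_sub: "space (?M {1..n}) \<subseteq> space (?B {1..n})" by (auto simp: space_PiM PiE_def)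
  have indicator_prod: "(\<Prod>i\<in>I. indicator G (z i) :: ennreal) = (if \<forall>i\<in>I. z i \<in> G then 1 else 0)" for z
    using \<open>finite I\<close> by (induction I rule: finite_induct) (auto simp: indicator_def)
  let ?E = "{z \<in> space (?M {1..n}). has_pattern n z \<sigma> \<and> (\<forall>i\<in>I. z i \<in> G)}"
  have ind: "indicator ?E z = (\<Prod>i\<in>I. indicator G (z i)) * F z" if "z \<in> space (?M {1..n})" for z
    using that space_sub JI(4) by (auto simp: indicator_prod F_def S_def indicator_def)
  have E: "?E \<in> sets (?M {1..n})"
  proof -
    have "(indicator ?E :: _ \<Rightarrow> ennreal) \<in> borel_measurable (?M {1..n})"
      by (rule iffD2[OF measurable_cong borel_measurable_times_ennreal[OF prod_meas F_M]]) (rule ind)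
    then have "?E \<inter> space (?M {1..n}) \<in> sets (?M {1..n})" by (simp only: borel_measurable_indicator_iff)
    also have "?E \<inter> space (?M {1..n}) = ?E" by auto
    finally show ?thesis .
  qed
  have "emeasure (?M {1..n}) ?E = (\<integral>\<^sup>+z. indicator ?E z \<partial>?M {1..n})"
    using E by (rule nn_integral_indicator[symmetric])
  also have "\<dots> = (\<integral>\<^sup>+z. (\<Prod>i\<in>I. indicator G (z i)) * F z \<partial>?M (J \<union> I))"
    unfolding JI(1) by (rule nn_integral_cong[OF ind])
  also have "\<dots> = (\<integral>\<^sup>+y. \<integral>\<^sup>+x. (\<Prod>i\<in>I. indicator G (merge J I (y, x) i)) * F (merge J I (y, x)) \<partial>?M I \<partial>?M J)"
    by (rule M.product_nn_integral_fold[OF JI(2-4)])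
      (use prod_meas F_M in \<open>simp add: JI(1) borel_measurable_times_ennreal\<close>)
  also have "\<dots> \<le> (\<integral>\<^sup>+y. K ^ card I * ennreal (1 / fact (card I)) \<partial>?M J)"
  proof (rule nn_integral_mono)
    fix y assume y: "y \<in> space (?M J)"
    then have y': "y \<in> space (?B J)" by (auto simp: space_PiM PiE_def)
    have prod_eq: "(\<Prod>i\<in>I. indicator G (merge J I (y, x) i) :: ennreal) = (\<Prod>i\<in>I. indicator G (x i))" for x
      using JI(2) by (intro prod.cong) auto
    have F_y: "(\<lambda>x. F (merge J I (y, x))) \<in> borel_measurable (?B I)"
      using measurable_compose[OF measurable_Pair1'[OF y'] measurable_compose[OF measurable_merge F[folded JI(1)]]] .
    have "(\<integral>\<^sup>+x. (\<Prod>i\<in>I. indicator G (merge J I (y, x) i)) * F (merge J I (y, x)) \<partial>?M I)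
       = (\<integral>\<^sup>+x. (\<Prod>i\<in>I. indicator G (x i)) * F (merge J I (y, x)) \<partial>?M I)"
      by (simp only: prod_eq)
    also have "\<dots> \<le> K ^ card I * (\<integral>\<^sup>+u. \<integral>\<^sup>+v. F (merge J I (y, \<lambda>i\<in>I. (u i, v i))) \<partial>?U \<partial>?U)"
      by (rule nn_integral_PiM_le_of_dominated[OF U \<mu> id_meas G dom JI(4) F_y])
    also have "\<dots> \<le> K ^ card I * (\<integral>\<^sup>+u. ennreal (1 / fact (card I)) \<partial>?U)"
    proof (intro mult_left_mono nn_integral_mono)
      fix u :: "nat \<Rightarrow> real"
      \<comment> \<open>Horizontal ranks ignore the ordinates, so \<open>0\<close> is an arbitrary filler for them.\<close>
      define h where "h i = \<sigma> (rank_by fst n (merge J I (y, \<lambda>i\<in>I. (u i, 0))) i)" for i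
      have "(\<integral>\<^sup>+v. F (merge J I (y, \<lambda>i\<in>I. (u i, v i))) \<partial>?U) \<le> (\<integral>\<^sup>+v. indicator (order_iso_set I h) v \<partial>?U)"
      proof (rule nn_integral_mono)
        fix v assume "v \<in> space ?U"
        then have v: "v \<in> extensional I" by (simp add: space_PiM PiE_def)
        let ?z = "merge J I (y, \<lambda>i\<in>I. (u i, v i))"
        have "v \<in> order_iso_set I h" if pat: "has_pattern n ?z \<sigma>"
        proof -
          have z: "?z i = (u i, v i)" if "i \<in> I" for i using that JI(2) by auto
          have "fst (merge J I (y, \<lambda>i\<in>I. (u i, 0)) i) = fst (?z i)" for i
            by (auto simp: merge_def)
          then have h: "h i = \<sigma> (rank_by fst n ?z i)" for i
            by (simp add: h_def rank_by_def)
          have "v i \<le> v j \<longleftrightarrow> h i \<le> h j" if "i \<in> I" "j \<in> I" for i j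
            using has_pattern_snd_le_iff[OF pat subsetD[OF I that(1)] subsetD[OF I that(2)]]
            by (simp only: h[symmetric] z[OF that(1)] z[OF that(2)] snd_conv)
          moreover have "inj_on v I"
          proof -
            have "inj_on (\<lambda>i. snd (?z i)) I"
              using pat I by (auto simp: has_pattern_def intro: inj_on_subset)
            moreover have "snd (?z i) = v i" if "i \<in> I" for i
              by (simp only: z[OF that] snd_conv)
            ultimately show ?thesis
              using inj_on_cong[of I "\<lambda>i. snd (?z i)" v] by blast
          qed
          ultimately show ?thesis using v by (auto simp: order_iso_set_def)
        qed
        then show "F ?z \<le> indicator (order_iso_set I h) v"
          by (auto simp: F_def S_def indicator_def)
      qed
      also have "\<dots> = emeasure ?U (order_iso_set I h)"
        using sets_order_iso_set[OF JI(4), of h] sets_PiM_cong[OF refl, of I "\<lambda>_. U" "\<lambda>_. borel"] U(2)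
        by (intro nn_integral_indicator) simp
      also have "\<dots> \<le> ennreal (1 / fact (card I))"
        by (rule emeasure_order_iso_set_le[OF U JI(4)])
      finally show "(\<integral>\<^sup>+v. F (merge J I (y, \<lambda>i\<in>I. (u i, v i))) \<partial>?U) \<le> ennreal (1 / fact (card I))" .
    qed simp
    also have "\<dots> = K ^ card I * ennreal (1 / fact (card I))"
      by (simp add: PU.emeasure_space_1)
    finally show "(\<integral>\<^sup>+x. (\<Prod>i\<in>I. indicator G (merge J I (y, x) i)) * F (merge J I (y, x)) \<partial>?M I)
       \<le> K ^ card I * ennreal (1 / fact (card I))" .
  qed
  also have "\<dots> = K ^ card I * ennreal (1 / fact (card I))"
    by (simp add: MJ.emeasure_space_1)
  finally show ?thesis .
qed

section \<open>Patterns of a permuton\<close>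

text \<open>Fubini for each pair \<open>i \<noteq> j\<close>: given the other points, \<open>f (z i)\<close> misses the single value
  \<open>f (z j)\<close> almost surely.\<close>

lemma AE_PiM_inj_on:
  fixes f :: "'a \<Rightarrow> real"
  assumes \<mu>: "prob_space \<mu>" and f[measurable]: "f \<in> borel_measurable \<mu>"
    and diffuse: "\<And>c. emeasure \<mu> {y \<in> space \<mu>. f y = c} = 0" and fin: "finite A"
  shows "AE z in (\<Pi>\<^sub>M i\<in>A. \<mu>). inj_on (\<lambda>i. f (z i)) A"
proof -
  let ?P = "\<Pi>\<^sub>M i\<in>A. \<mu>"
  interpret M: product_sigma_finite "\<lambda>_. \<mu>"
    by (intro product_sigma_finite.intro prob_space_imp_sigma_finite \<mu>)
  have "AE z in ?P. f (z i) = f (z j) \<longrightarrow> i = j" if "i \<in> A" "j \<in> A" for i j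
  proof (cases "i = j")
    case False
    define A' where "A' = A - {i}"
    have A': "A = insert i A'" "finite A'" "i \<notin> A'" "j \<in> A'" using that fin False by (auto simp: A'_def)
    have [measurable]: "(\<lambda>z. z i) \<in> measurable ?P \<mu>" "(\<lambda>z. z j) \<in> measurable ?P \<mu>"
      using that by (auto intro: measurable_component_singleton)
    have N: "{z \<in> space ?P. f (z i) = f (z j)} \<in> sets ?P" by measurable
    have "emeasure ?P {z \<in> space ?P. f (z i) = f (z j)}
        = (\<integral>\<^sup>+z. indicator {z \<in> space ?P. f (z i) = f (z j)} z \<partial>?P)"
      using N by simp
    also have "\<dots> = (\<integral>\<^sup>+x. \<integral>\<^sup>+y. indicator {z \<in> space ?P. f (z i) = f (z j)} (x(i := y)) \<partial>\<mu> \<partial>(\<Pi>\<^sub>M i\<in>A'. \<mu>))"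
      unfolding A'(1) by (rule M.product_nn_integral_insert[OF A'(2,3)]) (use N in \<open>simp add: A'(1)\<close>)
    also have "\<dots> = (\<integral>\<^sup>+x. 0 \<partial>(\<Pi>\<^sub>M i\<in>A'. \<mu>))"
    proof (rule nn_integral_cong)
      fix x assume "x \<in> space (\<Pi>\<^sub>M i\<in>A'. \<mu>)"
      have "(\<integral>\<^sup>+y. indicator {z \<in> space ?P. f (z i) = f (z j)} (x(i := y)) \<partial>\<mu>)
          \<le> (\<integral>\<^sup>+y. indicator {y \<in> space \<mu>. f y = f (x j)} y \<partial>\<mu>)"
        using False by (intro nn_integral_mono) (auto simp: indicator_def)
      also have "\<dots> = emeasure \<mu> {y \<in> space \<mu>. f y = f (x j)}"
        by (rule nn_integral_indicator) measurable
      finally show "(\<integral>\<^sup>+y. indicator {z \<in> space ?P. f (z i) = f (z j)} (x(i := y)) \<partial>\<mu>) = 0"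
        by (simp add: diffuse)
    qed
    finally have "{z \<in> space ?P. f (z i) = f (z j)} \<in> null_sets ?P" using N by auto
    then have "AE z in ?P. z \<notin> {z \<in> space ?P. f (z i) = f (z j)}" by (rule AE_not_in)
    then show ?thesis using AE_space by eventually_elim auto
  qed simp
  then have "AE z in ?P. \<forall>i\<in>A. \<forall>j\<in>A. f (z i) = f (z j) \<longrightarrow> i = j"
    using fin by (intro AE_finite_allI) auto
  then show ?thesis by eventually_elim (auto simp: inj_on_def)
qed

abbreviation "U01 \<equiv> uniform_measure lborel {0..1 :: real}"

lemma prob_space_U01: "prob_space U01"
  by (rule prob_space_uniform_measure) auto

text \<open>The two null-set conclusions are all that is kept of the uniform marginals.\<close>

lemma permutonD:
  assumes "permuton \<mu>"
  shows "prob_space \<mu>" "(\<lambda>x. x) \<in> measurable \<mu> borel" "space \<mu> = unit_square"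
    "\<And>c. emeasure \<mu> {y \<in> space \<mu>. fst y = c} = 0"
    "\<And>c. emeasure \<mu> {y \<in> space \<mu>. snd y = c} = 0"
    "fst \<in> borel_measurable \<mu>" "snd \<in> borel_measurable \<mu>"
proof -
  have sets: "sets \<mu> = sets (restrict_space borel unit_square)"
    using assms by (simp add: permuton_def)
  show id: "(\<lambda>x. x) \<in> measurable \<mu> borel"
    using measurable_cong_sets[OF sets refl, of "borel :: (real \<times> real) measure"]
      measurable_restrict_space1[OF measurable_ident, of borel unit_square] by (simp add: id_def)
  show "prob_space \<mu>" using assms by (simp add: permuton_def)
  show "space \<mu> = unit_square"
    using sets_eq_imp_space_eq[OF sets] by (simp add: space_restrict_space)
  have "fst \<in> borel_measurable (borel :: (real \<times> real) measure)" "snd \<in> borel_measurable (borel :: (real \<times> real) measure)"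
    by (simp_all add: borel_prod[symmetric])
  from this[THEN measurable_compose[OF id]]
  show m: "fst \<in> borel_measurable \<mu>" "snd \<in> borel_measurable \<mu>" by simp_all
  have null: "emeasure U01 {c} = 0" for c
  proof -
    have "emeasure lborel ({0..1} \<inter> {c}) \<le> emeasure lborel {c}" by (intro emeasure_mono) auto
    then show ?thesis by simp
  qed
  have pre: "{y \<in> space \<mu>. f y = c} = f -` {c} \<inter> space \<mu>" for f :: "real \<times> real \<Rightarrow> real" and c by auto
  show "emeasure \<mu> {y \<in> space \<mu>. fst y = c} = 0" for c
    using null[of c] assms unfolding pre
    by (subst emeasure_distr[OF m(1), symmetric]) (auto simp: permuton_def)
  show "emeasure \<mu> {y \<in> space \<mu>. snd y = c} = 0" for c
    using null[of c] assms unfolding pre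
    by (subst emeasure_distr[OF m(2), symmetric]) (auto simp: permuton_def)
qed

lemma AE_ex1_pattern:
  assumes "permuton \<mu>"
  shows "AE z in (\<Pi>\<^sub>M i\<in>{1..n}. \<mu>). \<exists>!\<sigma>. \<sigma> \<in> {\<sigma>. \<sigma> permutes {1..n}} \<and> has_pattern n z \<sigma>"
proof -
  note \<mu> = permutonD[OF assms]
  have "AE z in (\<Pi>\<^sub>M i\<in>{1..n}. \<mu>). inj_on (\<lambda>i. fst (z i)) {1..n}"
    by (rule AE_PiM_inj_on[OF \<mu>(1,6,4)]) simp
  moreover have "AE z in (\<Pi>\<^sub>M i\<in>{1..n}. \<mu>). inj_on (\<lambda>i. snd (z i)) {1..n}"
    by (rule AE_PiM_inj_on[OF \<mu>(1,7,5)]) simp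
  ultimately show ?thesis by eventually_elim (rule ex1_pattern)
qed

lemma sets_has_pattern_PiM:
  assumes "permuton \<mu>"
  shows "{z \<in> space (\<Pi>\<^sub>M i\<in>{1..n}. \<mu>). has_pattern n z \<sigma>} \<in> sets (\<Pi>\<^sub>M i\<in>{1..n}. \<mu>)"
proof -
  have "(\<lambda>z. z) -` {z \<in> space (\<Pi>\<^sub>M i\<in>{1..n}. borel). has_pattern n z \<sigma>} \<inter> space (\<Pi>\<^sub>M i\<in>{1..n}. \<mu>)
      \<in> sets (\<Pi>\<^sub>M i\<in>{1..n}. \<mu>)"
    by (rule measurable_sets[OF measurable_id_PiM[OF permutonD(2)[OF assms]] sets_has_pattern])
  also have "(\<lambda>z. z) -` {z \<in> space (\<Pi>\<^sub>M i\<in>{1..n}. borel). has_pattern n z \<sigma>} \<inter> space (\<Pi>\<^sub>M i\<in>{1..n}. \<mu>)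
      = {z \<in> space (\<Pi>\<^sub>M i\<in>{1..n}. \<mu>). has_pattern n z \<sigma>}"
    by (auto simp: space_PiM PiE_def)
  finally show ?thesis .
qed

lemma sum_pattern_prob:
  assumes "permuton \<mu>"
  shows "(\<Sum>\<sigma> | \<sigma> permutes {1..n}. pattern_prob \<mu> n \<sigma>) = 1"
proof -
  note [simp del] = One_nat_def
  interpret P: prob_space "\<Pi>\<^sub>M i\<in>{1..n}. \<mu>" by (intro prob_space_PiM permutonD(1)[OF assms])
  have "P.prob {z \<in> space (\<Pi>\<^sub>M i\<in>{1..n}. \<mu>). True} = (\<Sum>\<sigma> | \<sigma> permutes {1..n}. pattern_prob \<mu> n \<sigma>)"
    unfolding pattern_prob_def
  proof (rule P.prob_sum)
    show "AE z in (\<Pi>\<^sub>M i\<in>{1..n}. \<mu>). (\<forall>\<sigma>\<in>{\<sigma>. \<sigma> permutes {1..n}}. has_pattern n z \<sigma> \<longrightarrow> True) \<and>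
        (True \<longrightarrow> (\<exists>!\<sigma>. \<sigma> \<in> {\<sigma>. \<sigma> permutes {1..n}} \<and> has_pattern n z \<sigma>))"
      using AE_ex1_pattern[OF assms, of n] by simp
  qed (auto intro: finite_permutations sets_has_pattern_PiM[OF assms])
  then show ?thesis using P.prob_space by simp
qed

section \<open>Two-sided entropy bounds\<close>

text \<open>A distribution on \<open>n!\<close> permutations has entropy at most \<open>ln (n!)\<close>, and
  \<open>n! \<le> n ^ n\<close>.\<close>

lemma perm_entropy_le:
  assumes "permuton \<mu>"
  shows "perm_entropy \<mu> n \<le> real n * ln (real n)"
proof (cases "n = 0")
  case True
  have "perm_entropy \<mu> 0 = 0"
    using sum_pattern_prob[OF assms, of 0] by (simp add: perm_entropy_def)
  with True show ?thesis by simp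
next
  case False
  \<comment> \<open>One outcome, with the permutations as its classes: its own entropy is \<open>- 1 ln 1 = 0\<close>.\<close>
  have "- (\<Sum>s\<in>{()}. \<Sum>\<sigma> | \<sigma> permutes {1..n}. pattern_prob \<mu> n \<sigma> * ln (pattern_prob \<mu> n \<sigma>)) \<le>
      - (\<Sum>s\<in>{()}. (\<Sum>\<sigma> | \<sigma> permutes {1..n}. pattern_prob \<mu> n \<sigma>) * ln (\<Sum>\<sigma> | \<sigma> permutes {1..n}. pattern_prob \<mu> n \<sigma>))
      + ln (card {\<sigma>. \<sigma> permutes {1..n}}) * (\<Sum>s\<in>{()}. \<Sum>\<sigma> | \<sigma> permutes {1..n}. pattern_prob \<mu> n \<sigma>)"
  proof (rule entropy_refinement_le)
    show "{\<sigma>. \<sigma> permutes {1..n}} \<noteq> {}" by (auto intro: permutes_id)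
  qed (auto simp: pattern_prob_def finite_permutations)
  then have "perm_entropy \<mu> n \<le> ln (card {\<sigma>. \<sigma> permutes {1..n}})"
    by (simp add: perm_entropy_def sum_pattern_prob[OF assms, simplified])
  also have "card {\<sigma>. \<sigma> permutes {1..n}} = fact n" by (rule card_permutations) auto
  also have "ln (real (fact n)) \<le> ln (real n ^ n)"
  proof -
    have "real (fact n) \<le> real (n ^ n)" using fact_le_power[of n, where ?'a=real] by simp
    then show ?thesis by (subst ln_le_cancel_iff) (use False in auto)
  qed
  also have "\<dots> = real n * ln (real n)" using False by (simp add: ln_realpow)
  finally show ?thesis .
qed

text \<open>Refine the pattern by the set \<open>colour z\<close> of indices whose points fall into \<open>G\<close>. There are
  \<open>2 ^ n\<close> colours, so the refinement changes the entropy by at most \<open>n ln 2\<close>. A pattern together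
  with the colour \<open>I\<close> has probability at most \<open>K ^ card I / card I!\<close>, so its information
  content is at least \<open>card I ln n - n (1 + ln K)\<close>. Averaging turns \<open>card I\<close> into the
  expected number of points in \<open>G\<close>, which is \<open>n \<mu>(G)\<close>.\<close>

lemma perm_entropy_ge:
  assumes perm: "permuton \<mu>" and G: "G \<in> sets \<mu>" and K: "1 \<le> K" and n: "1 \<le> n"
    and dom: "\<And>B. B \<in> sets borel \<Longrightarrow> emeasure \<mu> (B \<inter> G) \<le> ennreal K * emeasure (U01 \<Otimes>\<^sub>M U01) B"
  shows "perm_entropy \<mu> n \<ge> measure \<mu> G * real n * ln (real n) - real n * (1 + ln K + ln 2)"
proof -
  note [simp del] = One_nat_def
  note \<mu> = permutonD[OF perm]
  let ?P = "\<Pi>\<^sub>M i\<in>{1..n}. \<mu>"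
  let ?S = "{\<sigma>. \<sigma> permutes {1..n}}"
  let ?C = "Pow {1..n}"
  interpret P: prob_space ?P by (intro prob_space_PiM \<mu>)
  define colour where "colour z = {i\<in>{1..n}. z i \<in> G}" for z :: "nat \<Rightarrow> real \<times> real"
  define q where "q \<sigma> I = P.prob {z \<in> space ?P. has_pattern n z \<sigma> \<and> colour z = I}" for \<sigma> I
  have in_G: "{z \<in> space ?P. z i \<in> G} \<in> sets ?P" if "i \<in> {1..n}" for i
    using measurable_sets[OF measurable_component_singleton[OF that, of "\<lambda>_. \<mu>"] G]
    by (simp add: vimage_def Int_def conj_commute)
  have class_sets: "{z \<in> space ?P. colour z = I} \<in> sets ?P" if "I \<in> ?C" for I
  proof -
    have "{z \<in> space ?P. colour z = I} = {z \<in> space ?P. \<forall>i\<in>{1..n}. z i \<in> G \<longleftrightarrow> i \<in> I}"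
      using that by (auto simp: colour_def)
    also have "\<dots> = {z \<in> space ?P. \<forall>i\<in>{1..n}. (z i \<in> G \<and> i \<in> I) \<or> (\<not> z i \<in> G \<and> i \<notin> I)}"
      by auto
    also have "\<dots> \<in> sets ?P"
      by (intro sets.sets_Collect_finite_All sets.sets_Collect_disj sets.sets_Collect_conj
          sets.sets_Collect_neg sets.sets_Collect_const in_G finite_atLeastAtMost; assumption)
    finally show ?thesis .
  qed
  have q_sets: "{z \<in> space ?P. has_pattern n z \<sigma> \<and> colour z = I} \<in> sets ?P" if "I \<in> ?C" for \<sigma> I
    by (intro sets.sets_Collect_conj class_sets that sets_has_pattern_PiM perm)
  have p_eq: "pattern_prob \<mu> n \<sigma> = (\<Sum>I\<in>?C. q \<sigma> I)" for \<sigma>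
    unfolding pattern_prob_def q_def
  proof (rule P.prob_sum)
    show "AE z in ?P. (\<forall>I\<in>?C. has_pattern n z \<sigma> \<and> colour z = I \<longrightarrow> has_pattern n z \<sigma>) \<and>
        (has_pattern n z \<sigma> \<longrightarrow> (\<exists>!I. I \<in> ?C \<and> (has_pattern n z \<sigma> \<and> colour z = I)))"
      by (rule AE_I2) (auto simp: colour_def)
  qed (auto intro: q_sets sets_has_pattern_PiM[OF perm])
  have class_prob: "P.prob {z \<in> space ?P. colour z = I} = (\<Sum>\<sigma>\<in>?S. q \<sigma> I)" if "I \<in> ?C" for I
    unfolding q_def
  proof (rule P.prob_sum)
    show "AE z in ?P. (\<forall>\<sigma>\<in>?S. has_pattern n z \<sigma> \<and> colour z = I \<longrightarrow> colour z = I) \<and>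
        (colour z = I \<longrightarrow> (\<exists>!\<sigma>. \<sigma> \<in> ?S \<and> (has_pattern n z \<sigma> \<and> colour z = I)))"
      using AE_ex1_pattern[OF perm, of n] by eventually_elim auto
  qed (use that q_sets class_sets in \<open>auto intro: finite_permutations\<close>)
  \<comment> \<open>The expected number of points in \<open>G\<close>, by linearity over the indices.\<close>
  have size: "(\<Sum>I\<in>?C. real (card I) * P.prob {z \<in> space ?P. colour z = I}) = real n * measure \<mu> G"
  proof -
    have "(\<Sum>I\<in>?C. real (card I) * P.prob {z \<in> space ?P. colour z = I})
        = (\<Sum>I\<in>?C. \<Sum>i\<in>{1..n}. of_bool (i \<in> I) * P.prob {z \<in> space ?P. colour z = I})"
    proof (rule sum.cong)
      fix I assume "I \<in> ?C"
      then have "real (card I) = (\<Sum>i\<in>{1..n}. of_bool (i \<in> I))"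
        by (simp add: Int_absorb1 Int_absorb2 Int_commute)
      then show "real (card I) * P.prob {z \<in> space ?P. colour z = I}
          = (\<Sum>i\<in>{1..n}. of_bool (i \<in> I) * P.prob {z \<in> space ?P. colour z = I})"
        by (simp only: sum_distrib_right)
    qed simp
    also have "\<dots> = (\<Sum>i\<in>{1..n}. \<Sum>I\<in>?C. of_bool (i \<in> I) * P.prob {z \<in> space ?P. colour z = I})"
      by (rule sum.swap)
    also have "\<dots> = (\<Sum>i\<in>{1..n}. P.prob {z \<in> space ?P. z i \<in> G})"
    proof (rule sum.cong)
      fix i assume i: "i \<in> {1..n}"
      have "P.prob {z \<in> space ?P. z i \<in> G} = (\<Sum>I\<in>{I\<in>?C. i \<in> I}. P.prob {z \<in> space ?P. colour z = I})"
      proof (rule P.prob_sum)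
        show "AE z in ?P. (\<forall>I\<in>{I\<in>?C. i \<in> I}. colour z = I \<longrightarrow> z i \<in> G) \<and>
          (z i \<in> G \<longrightarrow> (\<exists>!I. I \<in> {I\<in>?C. i \<in> I} \<and> colour z = I))"
          using i by (intro AE_I2) (auto simp: colour_def)
      qed (use class_sets in_G[OF i] in auto)
      also have "\<dots> = (\<Sum>I\<in>?C. of_bool (i \<in> I) * P.prob {z \<in> space ?P. colour z = I})"
        by (rule sum.mono_neutral_cong_left) auto
      finally show "(\<Sum>I\<in>?C. of_bool (i \<in> I) * P.prob {z \<in> space ?P. colour z = I})
          = P.prob {z \<in> space ?P. z i \<in> G}" by simp
    qed simp
    also have "\<dots> = (\<Sum>i\<in>{1..n}. measure \<mu> G)"
    proof (rule sum.cong)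
      fix i assume i: "i \<in> {1..n}"
      have "distr ?P \<mu> (\<lambda>z. z i) = \<mu>"
        using distr_PiM_component[of "{1..n}" "\<lambda>_. \<mu>" i] \<mu>(1) i by simp
      then have "measure \<mu> G = measure (distr ?P \<mu> (\<lambda>z. z i)) G" by simp
      also have "\<dots> = P.prob {z \<in> space ?P. z i \<in> G}"
        by (subst measure_distr[OF measurable_component_singleton[OF i, of "\<lambda>_. \<mu>"] G])
          (simp add: vimage_def Int_def conj_commute)
      finally show "P.prob {z \<in> space ?P. z i \<in> G} = measure \<mu> G" by simp
    qed simp
    finally show ?thesis by simp
  qed
  have q_term: "q \<sigma> I * (real (card I) * ln (real n) - real n * (1 + ln K)) \<le> - (q \<sigma> I * ln (q \<sigma> I))"
    if I: "I \<in> ?C" for \<sigma> I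
  proof (cases "q \<sigma> I = 0")
    case False
    then have pos: "q \<sigma> I > 0" unfolding q_def by (simp add: zero_less_measure_iff)
    have finI: "finite I" and cardI: "card I \<le> n"
      using I finite_subset[of I "{1..n}"] card_mono[of "{1..n}" I] by auto
    have "ennreal (q \<sigma> I) = emeasure ?P {z \<in> space ?P. has_pattern n z \<sigma> \<and> colour z = I}"
      by (simp add: q_def P.emeasure_eq_measure)
    also have "\<dots> \<le> emeasure ?P {z \<in> space ?P. has_pattern n z \<sigma> \<and> (\<forall>i\<in>I. z i \<in> G)}"
    proof (rule emeasure_mono)
      show "{z \<in> space ?P. has_pattern n z \<sigma> \<and> (\<forall>i\<in>I. z i \<in> G)} \<in> sets ?P"
        using I finI by (intro sets.sets_Collect_conj sets_has_pattern_PiM perm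
            sets.sets_Collect_finite_All in_G) auto
    qed (auto simp: colour_def)
    also have "\<dots> \<le> ennreal K ^ card I * ennreal (1 / fact (card I))"
      using prob_space_U01 I by (intro emeasure_pattern_in_le[OF _ _ \<mu>(1,2) G dom]) auto
    also have "\<dots> = ennreal (K ^ card I / fact (card I))"
      using K by (simp add: ennreal_power flip: ennreal_mult)
    finally have "q \<sigma> I \<le> K ^ card I / fact (card I)"
      using K by (subst (asm) ennreal_le_iff) auto
    also have "\<dots> \<le> K ^ n * (exp (real n) / real n ^ card I)"
    proof -
      have "K ^ card I \<le> K ^ n" using K cardI by (rule power_increasing[rotated])
      moreover have "1 / fact (card I) \<le> exp (real n) / real n ^ card I"
        using power_le_exp_mult_fact[of n "card I"] n by (simp add: field_simps)
      ultimately have "K ^ card I * (1 / fact (card I)) \<le> K ^ n * (exp (real n) / real n ^ card I)"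
        using K by (intro mult_mono) auto
      then show ?thesis by simp
    qed
    finally have "ln (q \<sigma> I) \<le> ln (K ^ n * (exp (real n) / real n ^ card I))"
      using pos K n by (subst ln_le_cancel_iff) auto
    also have "\<dots> = real n * ln K + (real n - real (card I) * ln (real n))"
      using K n by (simp add: ln_mult ln_div ln_realpow)
    finally have "real (card I) * ln (real n) - real n * (1 + ln K) \<le> - ln (q \<sigma> I)"
      by (simp add: algebra_simps)
    then have "q \<sigma> I * (real (card I) * ln (real n) - real n * (1 + ln K)) \<le> q \<sigma> I * (- ln (q \<sigma> I))"
      using pos by (intro mult_left_mono) auto
    then show ?thesis by simp
  qed simp
  have total: "(\<Sum>\<sigma>\<in>?S. \<Sum>I\<in>?C. q \<sigma> I) = 1"
    using sum_pattern_prob[OF perm, of n] by (simp only: p_eq)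
  have "measure \<mu> G * real n * ln (real n) - real n * (1 + ln K)
      = ln (real n) * (\<Sum>I\<in>?C. real (card I) * (\<Sum>\<sigma>\<in>?S. q \<sigma> I))
        - real n * (1 + ln K) * (\<Sum>\<sigma>\<in>?S. \<Sum>I\<in>?C. q \<sigma> I)"
    using size class_prob by (simp add: total)
  also have "\<dots> = (\<Sum>\<sigma>\<in>?S. \<Sum>I\<in>?C. q \<sigma> I * (real (card I) * ln (real n) - real n * (1 + ln K)))"
  proof -
    have "(\<Sum>I\<in>?C. real (card I) * (\<Sum>\<sigma>\<in>?S. q \<sigma> I)) = (\<Sum>\<sigma>\<in>?S. \<Sum>I\<in>?C. real (card I) * q \<sigma> I)"
      by (subst sum.swap) (simp add: sum_distrib_left)
    then show ?thesis
      by (simp add: sum_distrib_left sum_subtractf right_diff_distrib mult_ac)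
  qed
  also have "\<dots> \<le> (\<Sum>\<sigma>\<in>?S. \<Sum>I\<in>?C. - (q \<sigma> I * ln (q \<sigma> I)))"
    by (intro sum_mono q_term)
  also have "\<dots> = - (\<Sum>\<sigma>\<in>?S. \<Sum>I\<in>?C. q \<sigma> I * ln (q \<sigma> I))"
    by (simp add: sum_negf)
  also have "\<dots> \<le> - (\<Sum>\<sigma>\<in>?S. (\<Sum>I\<in>?C. q \<sigma> I) * ln (\<Sum>I\<in>?C. q \<sigma> I)) + ln (card ?C) * (\<Sum>\<sigma>\<in>?S. \<Sum>I\<in>?C. q \<sigma> I)"
    by (rule entropy_refinement_le) (auto simp: q_def finite_permutations)
  also have "\<dots> = perm_entropy \<mu> n + real n * ln 2"
    unfolding total by (simp add: perm_entropy_def p_eq card_Pow ln_realpow)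
  finally show ?thesis by (simp add: algebra_simps)
qed

section \<open>Sets of bounded density\<close>

lemma emeasure_U01_pair:
  assumes B: "B \<in> sets borel"
  shows "emeasure (U01 \<Otimes>\<^sub>M U01) B = emeasure lborel (B \<inter> unit_square)"
proof -
  have U: "U01 = density lborel (indicator {0..1})"
    unfolding uniform_measure_def by (simp add: divide_ennreal_def)
  have fin: "sigma_finite_measure (density lborel (indicator {0..1 :: real}))"
    using prob_space_imp_sigma_finite[OF prob_space_U01] by (simp only: U)
  have "U01 \<Otimes>\<^sub>M U01 = density (lborel \<Otimes>\<^sub>M lborel) (\<lambda>(x, y). indicator {0..1} x * indicator {0..1} y)"
    unfolding U by (rule pair_measure_density) (auto intro: lborel.sigma_finite_measure_axioms fin)
  also have "\<dots> = density lborel (indicator unit_square)"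
    unfolding lborel_prod by (intro arg_cong[where f="density lborel"]) (auto simp: indicator_def fun_eq_iff)
  finally have eq: "U01 \<Otimes>\<^sub>M U01 = density lborel (indicator unit_square)" .
  have sq: "unit_square \<in> sets (lborel :: (real \<times> real) measure)"
    by (simp add: borel_closed closed_Times)
  have "emeasure (U01 \<Otimes>\<^sub>M U01) B = (\<integral>\<^sup>+x. indicator unit_square x * indicator B x \<partial>lborel)"
    unfolding eq using B sq by (intro emeasure_density) auto
  also have "\<dots> = (\<integral>\<^sup>+x. indicator (B \<inter> unit_square) x \<partial>lborel)"
    by (intro nn_integral_cong) (auto simp: indicator_def)
  also have "\<dots> = emeasure lborel (B \<inter> unit_square)"
    using B sq by (intro nn_integral_indicator) auto
  finally show ?thesis .
qed

text \<open>Off a Lebesgue-null set carrying the singular part, \<open>\<mu>\<close> has a density that is finite almost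
  everywhere. Its sublevel sets therefore exhaust the absolutely continuous mass, and on each of them
  \<open>\<mu>\<close> is dominated by a multiple of Lebesgue measure.\<close>

lemma ex_bounded_density_set:
  assumes perm: "permuton \<mu>" and dec: "lebesgue_decomposition lebesgue_square \<mu> \<mu>_ac \<mu>_s"
    and e: "0 < (e :: real)"
  obtains G K where "G \<in> sets \<mu>" "1 \<le> K"
    "\<And>B. B \<in> sets borel \<Longrightarrow> emeasure \<mu> (B \<inter> G) \<le> ennreal K * emeasure (U01 \<Otimes>\<^sub>M U01) B"
    "measure \<mu>_ac (space \<mu>_ac) - e < measure \<mu> G"
proof -
  note \<mu> = permutonD[OF perm]
  interpret \<mu>: prob_space \<mu> by fact
  let ?L = lebesgue_square
  have sq: "unit_square \<in> sets (lborel :: (real \<times> real) measure)"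
    by (simp add: borel_closed closed_Times)
  have sets_L: "sets ?L = sets \<mu>"
    using perm by (simp add: permuton_def sets_restrict_space)
  have space_L: "space ?L = space \<mu>" using sets_L by (rule sets_eq_imp_space_eq)
  interpret L: sigma_finite_measure ?L
    by (rule sigma_finite_measure_restrict_space[OF lborel.sigma_finite_measure_axioms sq])
  have sets: "sets \<mu>_ac = sets \<mu>" "sets \<mu>_s = sets \<mu>"
    and sum: "\<And>A. A \<in> sets \<mu> \<Longrightarrow> emeasure \<mu> A = emeasure \<mu>_ac A + emeasure \<mu>_s A"
    and ac: "absolutely_continuous ?L \<mu>_ac"
    and sing: "mutually_singular ?L \<mu>_s"
    using dec by (auto simp: lebesgue_decomposition_def)
  have spaces: "space \<mu>_ac = space \<mu>" "space \<mu>_s = space \<mu>"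
    using sets by (auto dest: sets_eq_imp_space_eq)
  obtain S where S: "S \<in> sets ?L" "emeasure ?L S = 0" "emeasure \<mu>_s (space \<mu> - S) = 0"
    using sing unfolding mutually_singular_def spaces by blast
  have "emeasure \<mu>_ac (space \<mu>) \<le> emeasure \<mu> (space \<mu>)"
    by (subst sum) auto
  then have fin: "finite_measure \<mu>_ac"
    using \<mu>.emeasure_space_1 by (intro finite_measureI) (auto simp: spaces top_unique)
  then interpret ac: finite_measure \<mu>_ac .
  define f where "f = RN_deriv ?L \<mu>_ac"
  have f[measurable]: "f \<in> borel_measurable ?L" by (simp add: f_def)
  have dens: "density ?L f = \<mu>_ac"
    unfolding f_def using ac sets sets_L by (intro L.density_RN_deriv) auto
  define G where "G k = {x \<in> space ?L. f x \<le> of_nat k} - S" for k :: nat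
  have G: "G k \<in> sets \<mu>" for k
    unfolding G_def sets_L[symmetric] using S(1) by measurable
  have "AE x in ?L. f x \<noteq> \<infinity>"
    unfolding f_def using ac sets sets_L
    by (intro L.RN_deriv_finite ac.sigma_finite_measure_axioms) auto
  moreover have "AE x in ?L. x \<notin> S" using S by (intro AE_not_in) auto
  ultimately have "AE x in ?L. x \<in> (\<Union>k. G k)"
    using AE_space
  proof eventually_elim
    case (elim x)
    then obtain k :: nat where "f x < of_nat k"
      using ennreal_Ex_less_of_nat[of "f x"] by (auto simp: less_top)
    with elim show ?case by (auto simp: G_def intro!: exI[of _ k] less_imp_le)
  qed
  then have "AE x in \<mu>_ac. x \<in> (\<Union>k. G k)"
    using absolutely_continuous_AE[of \<mu>_ac ?L] ac sets sets_L by auto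
  then have "measure \<mu>_ac (\<Union>k. G k) = measure \<mu>_ac (space \<mu>_ac)"
    using G sets by (intro ac.finite_measure_eq_AE) auto
  moreover have "incseq G"
    unfolding incseq_def G_def by (auto elim: order_trans simp: of_nat_mono)
  ultimately have "(\<lambda>k. measure \<mu>_ac (G k)) \<longlonglongrightarrow> measure \<mu>_ac (space \<mu>_ac)"
    using ac.finite_Lim_measure_incseq[of G] G sets by auto
  then have "\<forall>\<^sub>F k in sequentially. measure \<mu>_ac (space \<mu>_ac) - e < measure \<mu>_ac (G k)"
    using e by (intro order_tendstoD) auto
  then obtain k where k: "1 \<le> k" "measure \<mu>_ac (space \<mu>_ac) - e < measure \<mu>_ac (G k)"
    using eventually_conj[OF _ eventually_ge_at_top[of 1]] eventually_happens'[OF sequentially_bot] by (metis (mono_tags, lifting))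
  show thesis
  proof (rule that[of "G k" "real k"])
    show "G k \<in> sets \<mu>" by (rule G)
    show "1 \<le> real k" using k by simp
    have "emeasure \<mu>_ac (G k) \<le> emeasure \<mu> (G k)" by (subst sum[OF G]) simp
    then have "measure \<mu>_ac (G k) \<le> measure \<mu> (G k)"
      by (simp add: ac.emeasure_eq_measure \<mu>.emeasure_eq_measure)
    with k show "measure \<mu>_ac (space \<mu>_ac) - e < measure \<mu> (G k)" by simp
    fix B :: "(real \<times> real) set" assume B: "B \<in> sets borel"
    have BG: "B \<inter> G k \<in> sets \<mu>"
    proof -
      have "(\<lambda>x. x) -` B \<inter> space \<mu> \<in> sets \<mu>" using \<mu>(2) B by (rule measurable_sets)
      then have "((\<lambda>x. x) -` B \<inter> space \<mu>) \<inter> G k \<in> sets \<mu>" using G by (rule sets.Int)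
      also have "((\<lambda>x. x) -` B \<inter> space \<mu>) \<inter> G k = B \<inter> G k"
        using sets.sets_into_space[OF G[of k]] by auto
      finally show ?thesis .
    qed
    have "emeasure \<mu>_s (B \<inter> G k) \<le> emeasure \<mu>_s (space \<mu> - S)"
      using S(1) sets sets_L by (intro emeasure_mono) (auto simp: G_def space_L)
    then have "emeasure \<mu> (B \<inter> G k) = emeasure \<mu>_ac (B \<inter> G k)"
      using S(3) sum[OF BG] by simp
    also have "\<dots> = (\<integral>\<^sup>+x. f x * indicator (B \<inter> G k) x \<partial>?L)"
      unfolding dens[symmetric] using f BG sets_L by (intro emeasure_density) auto
    also have "\<dots> \<le> (\<integral>\<^sup>+x. of_nat k * indicator (B \<inter> G k) x \<partial>?L)"
      by (intro nn_integral_mono) (auto simp: G_def indicator_def)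
    also have "\<dots> = of_nat k * emeasure ?L (B \<inter> G k)"
      using BG sets_L by (intro nn_integral_cmult_indicator) auto
    also have "emeasure ?L (B \<inter> G k) = emeasure lborel (B \<inter> G k)"
      using sq sets.sets_into_space[OF G[of k]] \<mu>(3) by (intro emeasure_restrict_space) auto
    also have "of_nat k * \<dots> \<le> of_nat k * emeasure lborel (B \<inter> unit_square)"
      using sets.sets_into_space[OF G[of k]] \<mu>(3) B sq by (intro mult_left_mono emeasure_mono) auto
    also have "\<dots> = ennreal (real k) * emeasure (U01 \<Otimes>\<^sub>M U01) B"
      by (simp add: emeasure_U01_pair[OF B] ennreal_of_nat_eq_real_of_nat)
    finally show "emeasure \<mu> (B \<inter> G k) \<le> ennreal (real k) * emeasure (U01 \<Otimes>\<^sub>M U01) B" .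
  qed
qed

text \<open>Dividing the lower bound by \<open>n ln n\<close> makes its linear error term vanish, so each set \<open>G\<close>
  gives \<open>\<mu>(G)\<close> as a lower bound, and these masses approach that of \<open>\<mu>_ac\<close>.\<close>

lemma liminf_perm_entropy_ge:
  assumes perm: "permuton \<mu>" and dec: "lebesgue_decomposition lebesgue_square \<mu> \<mu>_ac \<mu>_s"
  shows "ereal (measure \<mu>_ac (space \<mu>_ac)) \<le> liminf (\<lambda>n. ereal (perm_entropy \<mu> n / (real n * ln (real n))))"
proof (rule ereal_le_epsilon2)
  fix e :: real assume e: "0 < e"
  let ?m = "measure \<mu>_ac (space \<mu>_ac)"
  obtain G K where G: "G \<in> sets \<mu>" and K: "1 \<le> K"
    and dom: "\<And>B. B \<in> sets borel \<Longrightarrow> emeasure \<mu> (B \<inter> G) \<le> ennreal K * emeasure (U01 \<Otimes>\<^sub>M U01) B"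
    and m: "?m - e < measure \<mu> G"
    using ex_bounded_density_set[OF perm dec e] by blast
  define C where "C = 1 + ln K + ln 2"
  have "measure \<mu> G - C / ln (real n) \<le> perm_entropy \<mu> n / (real n * ln (real n))" if n: "2 \<le> n" for n
  proof -
    have pos: "0 < real n * ln (real n)" using n by simp
    have "(measure \<mu> G - C / ln (real n)) * (real n * ln (real n)) = measure \<mu> G * real n * ln (real n) - real n * C"
      using n by (simp add: field_simps)
    also have "\<dots> \<le> perm_entropy \<mu> n"
      unfolding C_def using n by (intro perm_entropy_ge perm G K dom) auto
    finally show ?thesis using pos by (simp add: pos_le_divide_eq)
  qed
  then have ev: "\<forall>\<^sub>F n in sequentially. ereal (measure \<mu> G - C / ln (real n)) \<le> ereal (perm_entropy \<mu> n / (real n * ln (real n)))"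
    by (intro eventually_sequentiallyI[of 2]) simp
  have "filterlim (\<lambda>n. ln (real n)) at_top sequentially"
    by (rule filterlim_compose[OF ln_at_top filterlim_real_sequentially])
  then have "(\<lambda>n. C / ln (real n)) \<longlonglongrightarrow> 0"
    by (rule tendsto_divide_0[OF tendsto_const filterlim_at_top_imp_at_infinity])
  then have "(\<lambda>n. measure \<mu> G - C / ln (real n)) \<longlonglongrightarrow> measure \<mu> G - 0"
    by (intro tendsto_diff tendsto_const)
  then have "liminf (\<lambda>n. ereal (measure \<mu> G - C / ln (real n))) = ereal (measure \<mu> G)"
    by (intro lim_imp_Liminf) auto
  with Liminf_mono[OF ev] have "ereal (measure \<mu> G) \<le> liminf (\<lambda>n. ereal (perm_entropy \<mu> n / (real n * ln (real n))))"
    by simp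
  then have "ereal (measure \<mu> G) + ereal e \<le> liminf (\<lambda>n. ereal (perm_entropy \<mu> n / (real n * ln (real n)))) + ereal e"
    by (rule add_right_mono)
  moreover have "ereal ?m \<le> ereal (measure \<mu> G) + ereal e" using m by simp
  ultimately show "ereal ?m \<le> liminf (\<lambda>n. ereal (perm_entropy \<mu> n / (real n * ln (real n)))) + ereal e"
    by (rule order_trans[rotated])
qed

theorem theorem1p1:
  fixes \<mu> :: "(real \<times> real) measure"
  assumes "permuton \<mu>"
  shows "(absolutely_continuous lebesgue_square \<mu> \<longrightarrow>
            (\<lambda>n. perm_entropy \<mu> n / (real n * ln (real n))) \<longlonglongrightarrow> 1) \<and>
         (\<forall>\<mu>_ac \<mu>_s. lebesgue_decomposition lebesgue_square \<mu> \<mu>_ac \<mu>_s \<longrightarrow>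
            liminf (\<lambda>n. ereal (perm_entropy \<mu> n / (real n * ln (real n))))
              \<ge> ereal (measure \<mu>_ac (space \<mu>_ac)))"
proof (intro conjI impI allI)
  fix \<mu>_ac \<mu>_s assume "lebesgue_decomposition lebesgue_square \<mu> \<mu>_ac \<mu>_s"
  then show "ereal (measure \<mu>_ac (space \<mu>_ac)) \<le> liminf (\<lambda>n. ereal (perm_entropy \<mu> n / (real n * ln (real n))))"
    by (rule liminf_perm_entropy_ge[OF assms])
next
  assume ac: "absolutely_continuous lebesgue_square \<mu>"
  interpret \<mu>: prob_space \<mu> by (rule permutonD(1)[OF assms])
  \<comment> \<open>If \<open>\<mu>\<close> is absolutely continuous, it is its own absolutely continuous part.\<close>
  have "mutually_singular lebesgue_square (null_measure \<mu>)"
    unfolding mutually_singular_def by (intro bexI[of _ "{}"]) auto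
  then have "lebesgue_decomposition lebesgue_square \<mu> \<mu> (null_measure \<mu>)"
    using ac by (simp add: lebesgue_decomposition_def)
  from liminf_perm_entropy_ge[OF assms this]
  have "1 \<le> liminf (\<lambda>n. ereal (perm_entropy \<mu> n / (real n * ln (real n))))"
    by (simp add: \<mu>.prob_space one_ereal_def)
  moreover have "limsup (\<lambda>n. ereal (perm_entropy \<mu> n / (real n * ln (real n)))) \<le> 1"
  proof (rule Limsup_bounded, rule eventually_sequentiallyI[of 2])
    fix n :: nat assume "2 \<le> n"
    then have "0 < real n * ln (real n)" by simp
    then show "ereal (perm_entropy \<mu> n / (real n * ln (real n))) \<le> 1"
      using perm_entropy_le[OF assms, of n] by (simp add: one_ereal_def pos_divide_le_eq)
  qed
  ultimately show "(\<lambda>n. perm_entropy \<mu> n / (real n * ln (real n))) \<longlonglongrightarrow> 1"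
    by (intro limsup_le_liminf_real) (simp_all add: one_ereal_def)
qed

end
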